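(* Let $A\in\mathbb C^{n\times n}$, let $\lambda_0$ be a simple eigenvalue of $A$, and let $\varepsilon_0>0$ be as in the context. Given $\varepsilon\in(0,\varepsilon_0]$, consider the differential system $$\dot E=-P_E(S)+\mathrm{Re}\langle E,S\rangle\,E,\qquad E\in\mathcal S_1\cap\mathcal M_2,\qquad( * )$$ where $S=S(E)$ and the orthogonal projection $P_E$ onto $T_E\mathcal M_2$ are defined in the context. Then the right-hand side of $( * )$ is antiparallel to the projection onto $\mathcal T_E\mathcal S_1\cap\mathcal T_E\mathcal M_2$ of the gradient of $|y^Hx|$ (as a function of $E$). More precisely, along solutions of $( * )$, $$\frac{\mathrm d}{\mathrm dt}|y^Hx|=-\varepsilon\,|y^Hx|\,\|P_E(S)-\mathrm{Re}\langle E,S\rangle E\|_F^2 .$$ In particular, $\frac{\mathrm d}{\mathrm dt}|y^Hx|=0$ if and only if $\dot E=0$.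
   Context: For $A,B\in\mathbb C^{n\times n}$, $\langle A,B\rangle=\mathrm{trace}(A^HB)$ and $\|A\|_F=\sqrt{\langle A,A\rangle}$. $\mathcal S_1=\{E\in\mathbb C^{n\times n}:\|E\|_F=1\}$; gradients and orthogonal projections are with respect to the real inner product $\mathrm{Re}\langle\cdot,\cdot\rangle$. $\lambda_0$ is a simple eigenvalue of $A$, and $\varepsilon_0>0$ is fixed (it exists by continuity) such that for every $\varepsilon\in[0,\varepsilon_0]$ and $E\in\mathcal S_1$ the matrix $A+\varepsilon E$ has a simple eigenvalue $\lambda=\lambda(\varepsilon,E)$ close to $\lambda_0$ (the continuous continuation of $\lambda_0$, with $\lambda(0,E)=\lambda_0$). $x$ and $y$ are right and left eigenvectors of $A+\varepsilon E$ associated to $\lambda$, i.e. $(A+\varepsilon E)x=\lambda x$, $y^H(A+\varepsilon E)=\lambda y^H$, with $\|x\|_2=\|y\|_2=1$. For a singular matrix $M$ with a simple zero eigenvalue, its group inverse is the unique $G$ with $MG=GM$, $GMG=G$, $MGM=M$. $G$ denotes the group inverse of $A+\varepsilon E-\lambda I$, and $S=yy^HG^H+G^Hxx^H$. $\mathcal M_2$ is the manifold of matrices in $\mathbb C^{n\times n}$ of rank exactly $2$. Each $E\in\mathcal M_2$ can be written $E=UTV^H$ with $U,V\in\mathbb C^{n\times2}$ having orthonormal columns and $T\in\mathbb C^{2\times2}$ nonsingular; the orthogonal projection of $Z\in\mathbb C^{n\times n}$ onto the tangent space $T_E\mathcal M_2$ is $P_E(Z)=Z-(I-UU^H)Z(I-VV^H)$.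 *)

theory Defs
  imports "HOL-Analysis.Analysis" "HOL-Computational_Algebra.Polynomial"
begin

section \<open>Matrices, inner product, norm\<close>

definition ctrans :: "complex^'a^'b \<Rightarrow> complex^'b^'a"
  where "ctrans M = (\<chi> i j. cnj (M $ j $ i))"

definition cvec :: "complex^'a \<Rightarrow> complex^'a"
  where "cvec v = (\<chi> i. cnj (v $ i))"

text \<open>\<open>vdot y x\<close> is \<open>y\<^sup>H x\<close> and \<open>outer x y\<close> is \<open>x y\<^sup>H\<close>.\<close>

definition vdot :: "complex^'a \<Rightarrow> complex^'a \<Rightarrow> complex"
  where "vdot y x = (\<Sum>i\<in>UNIV. cnj (y $ i) * x $ i)"

definition outer :: "complex^'a \<Rightarrow> complex^'b \<Rightarrow> complex^'b^'a"
  where "outer x y = (\<chi> i j. x $ i * cnj (y $ j))"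

definition frob_inner :: "complex^'n^'n \<Rightarrow> complex^'n^'n \<Rightarrow> complex"
  where "frob_inner M N = trace (ctrans M ** N)"

definition frob_norm :: "complex^'n^'n \<Rightarrow> real"
  where "frob_norm M = sqrt (Re (frob_inner M M))"

text \<open>The library's inner product and norm on \<^typ>\<open>complex^'n^'n\<close> are the Frobenius ones, so the
  topology and the derivatives of the library are taken with respect to them.\<close>

lemma Re_frob_inner: "Re (frob_inner M N) = inner M N"
proof -
  have "Re (frob_inner M N) = (\<Sum>i\<in>UNIV. \<Sum>k\<in>UNIV. Re (cnj (M $ k $ i) * N $ k $ i))"
    by (simp add: frob_inner_def trace_def ctrans_def matrix_matrix_mult_def)
  also have "\<dots> = (\<Sum>k\<in>UNIV. \<Sum>i\<in>UNIV. Re (cnj (M $ k $ i) * N $ k $ i))"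
    by (rule sum.swap)
  finally show ?thesis
    by (simp add: inner_vec_def inner_complex_def)
qed

lemma frob_norm_eq: "frob_norm M = norm M"
  by (simp add: frob_norm_def Re_frob_inner norm_eq_sqrt_inner)

section \<open>Simple eigenvalues, eigenvectors, group inverse\<close>

definition charpoly :: "complex^'n^'n \<Rightarrow> complex poly"
  where "charpoly M = det (\<chi> i j. [: - (M $ i $ j), of_bool (i = j) :])"

definition simple_eigenvalue :: "complex^'n^'n \<Rightarrow> complex \<Rightarrow> bool"
  where "simple_eigenvalue M mu \<longleftrightarrow> order mu (charpoly M) = 1"

definition unit_eigenvectors ::
    "complex^'n^'n \<Rightarrow> complex \<Rightarrow> complex^'n \<Rightarrow> complex^'n \<Rightarrow> bool"
  where "unit_eigenvectors M mu x y \<longleftrightarrow>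
    M *v x = mu *s x \<and> cvec y v* M = mu *s cvec y \<and> norm x = 1 \<and> norm y = 1"

definition group_inverse :: "complex^'n^'n \<Rightarrow> complex^'n^'n"
  where "group_inverse M = (THE G. M ** G = G ** M \<and> G ** M ** G = G \<and> M ** G ** M = M)"

definition S_matrix ::
    "complex^'n^'n \<Rightarrow> complex \<Rightarrow> complex^'n \<Rightarrow> complex^'n \<Rightarrow> complex^'n^'n"
  where "S_matrix M mu x y =
    (let G = group_inverse (M - mat mu)
     in outer y y ** ctrans G + ctrans G ** outer x x)"

section \<open>Manifolds, tangent spaces, projections, gradients\<close>

definition unit_sphere :: "(complex^'n^'n) set"
  where "unit_sphere = {E. frob_norm E = 1}"

definition rank2_manifold :: "(complex^'n^'n) set"
  where "rank2_manifold = {E. rank E = 2}"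

text \<open>Velocities at \<open>E\<close> of curves in \<open>M\<close> through \<open>E\<close>; used only for (embedded) submanifolds \<open>M\<close>.\<close>

definition tangent_space :: "(complex^'n^'n) set \<Rightarrow> complex^'n^'n \<Rightarrow> (complex^'n^'n) set"
  where "tangent_space M E =
    {H. \<exists>(\<gamma> :: real \<Rightarrow> complex^'n^'n) \<delta>. \<delta> > 0 \<and> (\<forall>t. \<bar>t\<bar> < \<delta> \<longrightarrow> \<gamma> t \<in> M) \<and> \<gamma> 0 = E \<and>
        (\<gamma> has_vector_derivative H) (at 0)}"

definition orth_proj :: "(complex^'n^'n) set \<Rightarrow> complex^'n^'n \<Rightarrow> complex^'n^'n"
  where "orth_proj W Z = (THE P. P \<in> W \<and> (\<forall>H\<in>W. Re (frob_inner H (Z - P)) = 0))"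

definition rank2_factors ::
    "complex^'n^'n \<Rightarrow> complex^2^'n \<Rightarrow> complex^2^2 \<Rightarrow> complex^2^'n \<Rightarrow> bool"
  where "rank2_factors E U T V \<longleftrightarrow>
    ctrans U ** U = mat 1 \<and> ctrans V ** V = mat 1 \<and> invertible T \<and> E = U ** T ** ctrans V"

text \<open>The projection \<open>P\<^sub>E\<close> onto the tangent space at \<open>E\<close> of the manifold of rank-2 matrices.
  The factors are not unique, but the value does not depend on them: see \<open>P_tan_eq\<close> below.\<close>

definition P_tan :: "complex^'n^'n \<Rightarrow> complex^'n^'n \<Rightarrow> complex^'n^'n"
  where "P_tan E Z =
    (let (U, V) = (SOME (U, V). \<exists>T. rank2_factors E U T V)
     in Z - (mat 1 - U ** ctrans U) ** Z ** (mat 1 - V ** ctrans V))"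

lemma ctrans_mult: "ctrans (M ** N) = ctrans N ** ctrans M"
  by (simp add: ctrans_def matrix_matrix_mult_def vec_eq_iff mult.commute)

lemma ctrans_ctrans [simp]: "ctrans (ctrans M) = M"
  by (simp add: ctrans_def vec_eq_iff)

lemma ctrans_mat_1 [simp]: "ctrans (mat 1) = mat 1"
  by (auto simp: ctrans_def mat_def vec_eq_iff)

lemma ctrans_invertible:
  assumes "invertible T" shows "invertible (ctrans T)"
proof -
  from assms obtain T' where "T ** T' = mat 1" "T' ** T = mat 1"
    by (auto simp: invertible_def)
  hence "ctrans T' ** ctrans T = mat 1" "ctrans T ** ctrans T' = mat 1"
    by (metis ctrans_mult ctrans_mat_1)+
  thus ?thesis by (auto simp: invertible_def)
qed

lemma rank2_factors_ctrans:
  assumes "rank2_factors E U T V" shows "rank2_factors (ctrans E) V (ctrans T) U"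
  using assms by (auto simp: rank2_factors_def ctrans_mult ctrans_invertible matrix_mul_assoc)

lemma rank2_factors_absorb:
  assumes "rank2_factors E U T V" "rank2_factors E U' T' V'"
  shows "(U' ** ctrans U') ** U = U"
proof -
  from assms obtain R where R: "T ** R = mat 1"
    by (auto simp: rank2_factors_def invertible_def)
  have "U = U ** T ** (ctrans V ** V) ** R"
    using assms(1) R by (simp add: rank2_factors_def flip: matrix_mul_assoc)
  also have "\<dots> = E ** V ** R"
  proof -
    have "E = U ** T ** ctrans V" using assms(1) by (simp add: rank2_factors_def)
    thus ?thesis by (simp only: matrix_mul_assoc)
  qed
  also have "\<dots> = U' ** (T' ** ctrans V' ** V ** R)"
  proof -
    have "E = U' ** T' ** ctrans V'" using assms(2) by (simp add: rank2_factors_def)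
    thus ?thesis by (simp only: matrix_mul_assoc)
  qed
  finally obtain C where C: "U = U' ** C" ..
  have "U' ** ctrans U' ** U = U' ** (ctrans U' ** U') ** C"
    by (simp add: C matrix_mul_assoc)
  thus ?thesis using assms(2) C by (simp add: rank2_factors_def)
qed

lemma rank2_factors_unique_range:
  assumes "rank2_factors E U T V" "rank2_factors E U' T' V'"
  shows "U ** ctrans U = U' ** ctrans U'"
proof -
  have 1: "(U' ** ctrans U') ** (U ** ctrans U) = U ** ctrans U"
    using rank2_factors_absorb[OF assms] by (simp add: matrix_mul_assoc)
  have 2: "(U ** ctrans U) ** (U' ** ctrans U') = U' ** ctrans U'"
    using rank2_factors_absorb[OF assms(2,1)] by (simp add: matrix_mul_assoc)
  have "U ** ctrans U = ctrans ((U' ** ctrans U') ** (U ** ctrans U))"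
    unfolding 1 by (simp add: ctrans_mult)
  also have "\<dots> = (U ** ctrans U) ** (U' ** ctrans U')"
    by (simp add: ctrans_mult)
  finally show ?thesis using 2 by simp
qed

lemma P_tan_eq:
  assumes "rank2_factors E U T V"
  shows "P_tan E Z = Z - (mat 1 - U ** ctrans U) ** Z ** (mat 1 - V ** ctrans V)"
proof -
  obtain U' V' where UV: "(SOME (U, V). \<exists>T. rank2_factors E U T V) = (U', V')"
    by (meson surj_pair)
  have "\<exists>p. case p of (U, V) \<Rightarrow> \<exists>T. rank2_factors E U T V"
    using assms by auto
  from someI_ex[OF this] obtain T' where T': "rank2_factors E U' T' V'"
    unfolding UV by auto
  show ?thesis
    unfolding P_tan_def UV
    using rank2_factors_unique_range[OF assms T']
      rank2_factors_unique_range[OF rank2_factors_ctrans[OF assms] rank2_factors_ctrans[OF T']]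
    by simp
qed

text \<open>\<open>has_gradient_on D f Z E\<close>: \<open>f(F) = f(E) + Re \<langle>Z, F - E\<rangle> + o(\<parallel>F - E\<parallel>)\<close> for \<open>F \<in> D\<close>.
  For a submanifold \<open>D\<close> this determines \<open>Z\<close> up to addition of matrices orthogonal to the tangent
  space of \<open>D\<close> at \<open>E\<close>. Both the ambient gradient at \<open>E\<close> of any differentiable extension
  of \<open>f\<close> and the Riemannian gradient on \<open>D\<close> satisfy it.\<close>

definition has_gradient_on ::
    "(complex^'n^'n) set \<Rightarrow> (complex^'n^'n \<Rightarrow> real) \<Rightarrow> complex^'n^'n \<Rightarrow> complex^'n^'n \<Rightarrow> bool"
  where "has_gradient_on D f Z E \<longleftrightarrow>
    (f has_derivative (\<lambda>H. Re (frob_inner Z H))) (at E within D)"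

definition antiparallel :: "complex^'n^'n \<Rightarrow> complex^'n^'n \<Rightarrow> bool"
  where "antiparallel X Y \<longleftrightarrow> (\<exists>c>0. X = - (c *\<^sub>R Y))"

section \<open>Continuation of the eigenvalue and the differential system\<close>

text \<open>\<open>lam \<epsilon> E\<close> follows the simple eigenvalue \<open>lam0\<close> of \<open>A\<close> continuously along
  \<open>\<epsilon> \<mapsto> A + \<epsilon> E\<close>; since all these eigenvalues are simple, this determines \<open>lam\<close> on
  \<open>[0, eps0] \<times> unit_sphere\<close>, and its continuity in \<open>E\<close> is a consequence.\<close>

definition simple_continuation ::
    "complex^'n^'n \<Rightarrow> complex \<Rightarrow> real \<Rightarrow> (real \<Rightarrow> complex^'n^'n \<Rightarrow> complex) \<Rightarrow> bool"
  where "simple_continuation A lam0 eps0 lam \<longleftrightarrow>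
    (\<forall>E\<in>unit_sphere. lam 0 E = lam0 \<and> continuous_on {0..eps0} (\<lambda>\<epsilon>. lam \<epsilon> E) \<and>
       (\<forall>\<epsilon>\<in>{0..eps0}. simple_eigenvalue (A + \<epsilon> *\<^sub>R E) (lam \<epsilon> E)))"

definition ode_rhs :: "(complex^'n^'n \<Rightarrow> complex^'n^'n) \<Rightarrow> complex^'n^'n \<Rightarrow> complex^'n^'n"
  where "ode_rhs S E = - P_tan E (S E) + Re (frob_inner E (S E)) *\<^sub>R E"

definition is_solution_on ::
    "real set \<Rightarrow> (complex^'n^'n \<Rightarrow> complex^'n^'n) \<Rightarrow> (real \<Rightarrow> complex^'n^'n) \<Rightarrow> bool"
  where "is_solution_on I S E \<longleftrightarrow> is_interval I \<and>
    (\<forall>t\<in>I. E t \<in> unit_sphere \<inter> rank2_manifold \<and>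
       (E has_vector_derivative ode_rhs S (E t)) (at t within I))"

end

theory Submission
  imports Defs
begin

text \<open>
  Write \<open>M = A + \<epsilon> E\<close>, \<open>N = M - \<lambda> I\<close>, \<open>G\<close> for the group inverse of \<open>N\<close> and \<open>f = |y\<^sup>H x|\<close>. The
  theorem rests on the formula that the derivative of \<open>f\<close> in direction \<open>H\<close> is
  \<open>\<epsilon> f Re \<langle>S, H\<rangle>\<close>; it makes \<open>\<epsilon> f S\<close> a gradient of \<open>f\<close>.

  \<^bold>\<open>Why the formula holds.\<close> The eigenvectors are only given up to an arbitrary phase, so they need not
  depend continuously on \<open>E\<close>. Since \<open>f\<close> is the phase-invariant ratio
  \<open>|v\<^sup>H u| / (\<parallel>v\<parallel> \<parallel>u\<parallel>)\<close> for any eigenvectors \<open>u\<close>, \<open>v\<close> proportional to \<open>x\<close>, \<open>y\<close>, they may be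
  rescaled so that their spectral component stays fixed. A rescaled right eigenvector has
  derivative \<open>- \<epsilon> G H x\<close>, a rescaled left one \<open>- \<epsilon> G\<^sup>H H\<^sup>H y\<close>
  (lemma \<open>normalised_eigenvector_has_derivative\<close>). As \<open>G x = 0\<close> and \<open>y\<^sup>H G = 0\<close>, the numerator is
  stationary, and only the two norms in the denominator contribute; their derivatives add up to
  \<open>- \<epsilon> Re \<langle>S, H\<rangle>\<close> (lemma \<open>eigenvalue_condition_has_derivative\<close>). The same two equations make the variation of the
  eigenvalue drop out at first order, so that only its continuity in \<open>E\<close> has to be known.

  \<^bold>\<open>Why the eigenvalue is continuous in \<open>E\<close>.\<close> It is defined by continuation along
  \<open>t \<mapsto> A + t E\<close>. Since it is simple for every \<open>t\<close>, compactness surrounds the path \<open>t \<mapsto> \<lambda>(t, E)\<close> by a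
  tube that contains no other eigenvalue of \<open>A + t E\<close>. For \<open>F\<close> near \<open>E\<close> no eigenvalue of \<open>A + t F\<close>
  lies on the boundary of a thinner tube, and the path of \<open>F\<close>, which starts at the centre, cannot
  leave it (lemma \<open>simple_continuation_tendsto\<close>).

  \<^bold>\<open>Why the right-hand side is a projected gradient.\<close> The tangent space of the sphere is the
  orthogonal complement of \<open>E\<close>, that of the rank-2 manifold is the kernel of
  \<open>Z \<mapsto> (I - U U\<^sup>H) Z (I - V V\<^sup>H)\<close>, an orthogonal projection which annihilates \<open>E\<close>. Hence
  \<open>R = P\<^sub>E(S) - Re \<langle>E, S\<rangle> E\<close> is the orthogonal projection of \<open>S\<close> onto the intersection, the system reads
  \<open>E' = - R\<close>, and along its solutions \<open>f' = - \<epsilon> f Re \<langle>S, R\<rangle> = - \<epsilon> f \<parallel>R\<parallel>\<^sup>2\<close>. Since \<open>f > 0\<close>, this vanishes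
  only if \<open>R = 0\<close>.
\<close>

section \<open>Complex matrices and their adjoints\<close>

lemma matrix_diff_ldistrib: "A ** (B - C) = A ** B - A ** (C :: 'a::ring_1^'n^'m)"
  by (simp add: matrix_matrix_mult_def vec_eq_iff right_diff_distrib sum_subtractf)

lemma matrix_diff_rdistrib: "(A - B) ** C = A ** C - B ** (C :: 'a::ring_1^'n^'m)"
  by (simp add: matrix_matrix_mult_def vec_eq_iff left_diff_distrib sum_subtractf)

lemma matrix_add_rdistrib: "(A + B) ** C = A ** C + B ** (C :: 'a::semiring_1^'n^'m)"
  by (simp add: matrix_matrix_mult_def vec_eq_iff distrib_right sum.distrib)

lemma mat_mult_vec: "mat c *v v = c *s (v :: 'a::comm_semiring_1^'n)"
  by (simp add: matrix_vector_mult_def mat_def vec_eq_iff if_distrib if_distribR cong: if_cong)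

lemma invertible_iff_kernel:
  fixes M :: "'a::field^'n^'n"
  shows "invertible M \<longleftrightarrow> (\<forall>v. M *v v = 0 \<longrightarrow> v = 0)"
  by (simp add: invertible_left_inverse matrix_left_invertible_ker)

lemma bounded_bilinear_matrix_vector_mult:
  "bounded_bilinear ((*v) :: complex^'n^'m \<Rightarrow> complex^'n \<Rightarrow> complex^'m)"
  unfolding bilinear_conv_bounded_bilinear[symmetric] bilinear_def linear_iff
  by (simp add: matrix_vector_mult_def vec_eq_iff sum.distrib distrib_left distrib_right
      scaleR_sum_right)

lemma bounded_bilinear_vdot:
  "bounded_bilinear (vdot :: complex^'n \<Rightarrow> complex^'n \<Rightarrow> complex)"
  unfolding bilinear_conv_bounded_bilinear[symmetric] bilinear_def linear_iff
  by (simp add: vdot_def distrib_left distrib_right sum.distrib scaleR_sum_right)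

interpretation mv: bounded_bilinear "(*v) :: complex^'n^'m \<Rightarrow> complex^'n \<Rightarrow> complex^'m"
  by (rule bounded_bilinear_matrix_vector_mult)

interpretation vd: bounded_bilinear "vdot :: complex^'n \<Rightarrow> complex^'n \<Rightarrow> complex"
  by (rule bounded_bilinear_vdot)

lemma bounded_linear_ctrans: "bounded_linear (ctrans :: complex^'n^'m \<Rightarrow> complex^'m^'n)"
  unfolding linear_conv_bounded_linear[symmetric] linear_iff
  by (simp add: ctrans_def vec_eq_iff)

lemmas ctrans_add = linear_add[OF bounded_linear.linear[OF bounded_linear_ctrans]]
lemmas ctrans_diff = linear_diff[OF bounded_linear.linear[OF bounded_linear_ctrans]]
lemmas ctrans_scaleR = linear_scale[OF bounded_linear.linear[OF bounded_linear_ctrans]]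

lemma ctrans_mat: "ctrans (mat c) = mat (cnj c)"
  by (auto simp: ctrans_def mat_def vec_eq_iff)

lemma vdot_scale_right: "vdot y (c *s x) = c * vdot y x"
  by (simp add: vdot_def sum_distrib_left mult_ac)

lemma vdot_scale_left: "vdot (c *s y) x = cnj c * vdot y x"
  by (simp add: vdot_def sum_distrib_left mult_ac)

lemma cnj_vdot: "cnj (vdot y x) = vdot x y"
  by (simp add: vdot_def mult_ac)

lemma inner_eq_Re_vdot: "inner u v = Re (vdot u v)"
  by (simp add: inner_vec_def inner_complex_def vdot_def)

lemma vdot_self: "vdot x x = of_real ((norm x)\<^sup>2)"
proof (rule complex_eqI)
  have "Im (vdot x x) = 0" using cnj_vdot[of x x] by (metis Reals_cnj_iff complex_is_Real_iff)
  then show "Im (vdot x x) = Im (complex_of_real ((norm x)\<^sup>2))" by simp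
qed (simp add: power2_norm_eq_inner inner_eq_Re_vdot)

lemma norm_vec_scale: "norm (c *s (v :: complex^'n)) = cmod c * norm v"
  by (simp add: norm_vec_def norm_mult L2_set_right_distrib)

lemma vdot_matrix: "vdot y (M *v x) = vdot (ctrans M *v y) x"
proof -
  have "vdot y (M *v x) = (\<Sum>i\<in>UNIV. \<Sum>j\<in>UNIV. cnj (y $ i) * (M $ i $ j * x $ j))"
    by (simp add: vdot_def matrix_vector_mult_def sum_distrib_left)
  also have "\<dots> = (\<Sum>j\<in>UNIV. \<Sum>i\<in>UNIV. cnj (y $ i) * (M $ i $ j * x $ j))"
    by (rule sum.swap)
  also have "\<dots> = vdot (ctrans M *v y) x"
    by (simp add: vdot_def matrix_vector_mult_def ctrans_def sum_distrib_right sum_distrib_left mult_ac)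
  finally show ?thesis .
qed

text \<open>Left eigenvectors of \<open>M\<close> are right eigenvectors of \<open>M\<^sup>H\<close>; in this form every statement about right
  eigenvectors also serves for the left ones.\<close>

lemma left_eigenvector_iff:
  "cvec y v* M = mu *s cvec y \<longleftrightarrow> ctrans M *v y = cnj mu *s y"
proof -
  have "cvec y v* M = cvec (ctrans M *v y)"
    by (simp add: cvec_def vector_matrix_mult_def matrix_vector_mult_def ctrans_def vec_eq_iff mult.commute)
  moreover have "mu *s cvec y = cvec (cnj mu *s y)" by (simp add: cvec_def vec_eq_iff)
  moreover have "cvec u = cvec v \<longleftrightarrow> u = v" for u v :: "complex^'n"
    by (auto simp: cvec_def vec_eq_iff)
  ultimately show ?thesis by simp
qed

lemma outer_mult_vec: "outer a b *v v = vdot b v *s a"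
  by (simp add: outer_def vdot_def matrix_vector_mult_def vec_eq_iff sum_distrib_right
      sum_distrib_left mult_ac)

lemma ctrans_outer: "ctrans (outer a b) = outer b a"
  by (simp add: ctrans_def outer_def vec_eq_iff)

lemma mult_outer: "M ** outer a b = outer (M *v a) b"
  by (simp add: outer_def matrix_matrix_mult_def matrix_vector_mult_def vec_eq_iff sum_distrib_right
      sum_distrib_left mult_ac)

lemma outer_mult: "outer a b ** M = outer a (ctrans M *v b)"
  by (simp add: outer_def matrix_matrix_mult_def matrix_vector_mult_def ctrans_def vec_eq_iff
      sum_distrib_left mult_ac)

lemma inner_outer: "inner (outer a b) H = Re (vdot a (H *v b))"
proof -
  have "inner (outer a b) H = (\<Sum>i\<in>UNIV. \<Sum>j\<in>UNIV. Re (cnj (a $ i) * b $ j * H $ i $ j))"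
    by (simp add: inner_vec_def inner_complex_def outer_def algebra_simps)
  also have "\<dots> = Re (vdot a (H *v b))"
    by (simp add: vdot_def matrix_vector_mult_def sum_distrib_left mult_ac)
  finally show ?thesis .
qed

lemma inner_matrix: "inner M N = Re (\<Sum>i\<in>UNIV. \<Sum>j\<in>UNIV. cnj (M $ i $ j) * N $ i $ j)"
  for M :: "complex^'n^'m"
  by (simp add: inner_vec_def inner_complex_def)

lemma inner_mult_left: "inner (A ** B) C = inner B (ctrans A ** (C :: complex^'n^'m))"
proof -
  have "(\<Sum>i\<in>UNIV. \<Sum>j\<in>UNIV. cnj ((A ** B) $ i $ j) * C $ i $ j)
      = (\<Sum>i\<in>UNIV. \<Sum>j\<in>UNIV. \<Sum>k\<in>UNIV. cnj (A$i$k) * cnj (B$k$j) * C$i$j)"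
    by (simp add: matrix_matrix_mult_def sum_distrib_right)
  also have "\<dots> = (\<Sum>j\<in>UNIV. \<Sum>i\<in>UNIV. \<Sum>k\<in>UNIV. cnj (A$i$k) * cnj (B$k$j) * C$i$j)"
    by (rule sum.swap)
  also have "\<dots> = (\<Sum>j\<in>UNIV. \<Sum>k\<in>UNIV. \<Sum>i\<in>UNIV. cnj (A$i$k) * cnj (B$k$j) * C$i$j)"
    by (intro sum.cong refl sum.swap)
  also have "\<dots> = (\<Sum>k\<in>UNIV. \<Sum>j\<in>UNIV. \<Sum>i\<in>UNIV. cnj (A$i$k) * cnj (B$k$j) * C$i$j)"
    by (rule sum.swap)
  also have "\<dots> = (\<Sum>k\<in>UNIV. \<Sum>j\<in>UNIV. cnj (B$k$j) * (ctrans A ** C) $ k $ j)"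
    by (simp add: matrix_matrix_mult_def ctrans_def sum_distrib_left mult_ac)
  finally show ?thesis by (simp only: inner_matrix)
qed

lemma inner_ctrans: "inner (ctrans A) (ctrans B) = inner A (B :: complex^'n^'m)"
  by (simp add: inner_vec_def ctrans_def inner_complex_def) (rule sum.swap)

lemma inner_mult_right: "inner (A ** B) C = inner A (C ** ctrans (B :: complex^'n^'m))"
proof -
  have "inner (A ** B) C = inner (ctrans (A ** B)) (ctrans C)" by (simp only: inner_ctrans)
  also have "\<dots> = inner (ctrans A) (ctrans (C ** ctrans B))"
    by (simp only: ctrans_mult inner_mult_left)
  finally show ?thesis by (simp only: inner_ctrans)
qed

section \<open>Simple eigenvalues and the group inverse\<close>

lemma poly_charpoly: "poly (charpoly M) z = det (mat z - M)"
proof -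
  have *: "poly [:- (M $ i $ j), of_bool (i = j):] z = (mat z - M) $ i $ j" for i j
    by (simp add: mat_def)
  show ?thesis
    unfolding charpoly_def det_def
    by (simp only: vec_lambda_beta poly_sum poly_mult poly_prod poly_of_int *)
qed

lemma charpoly_root_iff: "poly (charpoly M) z = 0 \<longleftrightarrow> (\<exists>v. v \<noteq> 0 \<and> M *v v = z *s v)"
proof -
  have "poly (charpoly M) z = 0 \<longleftrightarrow> \<not> (\<forall>v. (mat z - M) *v v = 0 \<longrightarrow> v = 0)"
    by (metis poly_charpoly invertible_det_nz invertible_iff_kernel)
  then show ?thesis by (auto simp: matrix_vector_mult_diff_rdistrib mat_mult_vec)
qed

text \<open>Needed because \<open>order\<close> is only meaningful for a nonzero polynomial: a number larger in modulus than the
  operator norm cannot be an eigenvalue.\<close>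

lemma charpoly_nonzero: "charpoly M \<noteq> 0"
proof
  assume "charpoly M = 0"
  obtain K where K: "\<And>v. norm (M *v v) \<le> norm v * K" "K > 0"
    using mv.bounded_linear_right[THEN bounded_linear.pos_bounded, of M] by blast
  obtain v where v: "v \<noteq> 0" "M *v v = of_real (K + 1) *s v"
    using \<open>charpoly M = 0\<close> charpoly_root_iff[of M "of_real (K + 1)"] by auto
  then have "norm (M *v v) = (K + 1) * norm v"
    using K(2) by (simp add: norm_vec_scale del: of_real_add)
  with K(1)[of v] v(1) show False by (simp add: algebra_simps)
qed

lemma simple_eigenvalue_eigenvector:
  assumes "simple_eigenvalue M mu"
  obtains v where "norm v = 1" "M *v v = mu *s v"
proof -
  have "poly (charpoly M) mu = 0"
    using assms charpoly_nonzero by (simp add: simple_eigenvalue_def order_root)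
  then obtain v where v: "v \<noteq> 0" "M *v v = mu *s v" by (auto simp: charpoly_root_iff)
  show thesis
  proof
    show "norm ((1 / norm v) *s v) = 1" using v(1) by (simp add: norm_vec_scale norm_divide)
    show "M *v ((1 / norm v) *s v) = mu *s ((1 / norm v) *s v)"
      using v(2) by (simp add: vector_scalar_commute vector_smult_assoc mult.commute)
  qed
qed

text \<open>The algebraic heart of simplicity. Let \<open>N = M - \<mu> I\<close>, let \<open>x\<close> have nonzero \<open>k\<close>-th entry and let
  \<open>w\<^sup>H v = v\<^sub>k / x\<^sub>k\<close>. Then \<open>z I - M - x w\<^sup>H\<close> differs from \<open>z I - M\<close> in the \<open>k\<close>-th column only, and because
  \<open>(z I - M) x = (z - \<mu>) x\<close> the new column is \<open>(z I - M) (e\<^sub>k - x / ((z - \<mu>) x\<^sub>k))\<close>. By Cramer's rule the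
  characteristic polynomial of \<open>M + x w\<^sup>H\<close> is that of \<open>M\<close> with one factor \<open>z - \<mu>\<close> replaced by
  \<open>z - \<mu> - 1\<close>. As \<open>\<mu>\<close> was a simple root, it is no root any more.\<close>

lemma bordered_matrix_invertible:
  assumes simple: "simple_eigenvalue M mu" and x: "M *v x = mu *s x" "x \<noteq> 0"
  obtains w where "vdot w x = 1" "invertible (M - mat mu + outer x w)"
proof -
  obtain k where k: "x $ k \<noteq> 0" using x(2) by (auto simp: vec_eq_iff)
  define w where "w = axis k (inverse (cnj (x $ k)))"
  have w: "vdot w v = v $ k / x $ k" for v
    by (simp add: w_def vdot_def axis_def if_distrib if_distribR divide_inverse mult.commute cong: if_cong)
  have "order mu (charpoly M) = 1" using simple by (simp add: simple_eigenvalue_def)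
  then obtain r where r: "charpoly M = [:-mu, 1:] * r" "\<not> [:-mu, 1:] dvd r"
    using order_decomp[OF charpoly_nonzero, of M mu] by auto
  have r0: "poly r mu \<noteq> 0" using r(2) by (simp add: poly_eq_0_iff_dvd)
  have eq: "poly (charpoly (M + outer x w)) z = poly ([:-mu - 1, 1:] * r) z" if "z \<noteq> mu" for z
  proof -
    define v where "v = axis k 1 - (1 / ((z - mu) * x $ k)) *s x"
    have vk: "v $ k = 1 - 1 / (z - mu)" using k by (simp add: v_def)
    have Mx: "(mat z - M) *v x = (z - mu) *s x"
      by (simp add: matrix_vector_mult_diff_rdistrib mat_mult_vec x(1) vec.scale_left_diff_distrib)
    have col: "(mat z - M) *v axis k 1 = column k (mat z - M)"
      by (simp add: matrix_vector_mult_def axis_def column_def vec_eq_iff if_distrib cong: if_cong)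
    have "(1 / ((z - mu) * x $ k)) *s ((z - mu) *s x) = (1 / x $ k) *s x"
      using that by (simp only: vector_smult_assoc) simp
    then have "(mat z - M) *v v = column k (mat z - M) - (1 / x $ k) *s x"
      by (simp only: v_def matrix_vector_mult_diff_distrib vector_scalar_commute Mx col)
    then have "(\<chi> i j. if j = k then ((mat z - M) *v v) $ i else (mat z - M) $ i $ j)
        = mat z - (M + outer x w)"
      by (auto simp: vec_eq_iff column_def outer_def w_def axis_def divide_inverse)
    then have "det (mat z - (M + outer x w)) = (1 - 1 / (z - mu)) * det (mat z - M)"
      using cramer_lemma[of k "mat z - M" v] vk by simp
    also have "\<dots> = (z - mu - 1) * poly r z"
      unfolding poly_charpoly[symmetric] r(1) using that by (simp add: field_simps)
    finally show ?thesis by (simp add: poly_charpoly algebra_simps)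
  qed
  have "charpoly (M + outer x w) = [:-mu - 1, 1:] * r" (is "?p = ?q")
  proof (rule ccontr)
    assume "?p \<noteq> ?q"
    then have "finite {z. poly (?p - ?q) z = 0}" by (intro poly_roots_finite) simp
    moreover have "UNIV - {mu} \<subseteq> {z. poly (?p - ?q) z = 0}" using eq by auto
    moreover have "infinite (UNIV - {mu} :: complex set)" by (simp add: infinite_UNIV_char_0)
    ultimately show False using finite_subset by blast
  qed
  then have "poly (charpoly (M + outer x w)) mu \<noteq> 0"
    using r0 by (simp add: algebra_simps)
  then have "invertible (M - mat mu + outer x w)"
    unfolding charpoly_root_iff invertible_iff_kernel
    by (metis (no_types, lifting) add_diff_eq diff_add_eq diff_eq_diff_eq eq_iff_diff_eq_0 mat_mult_vec matrix_vector_mult_add_rdistrib matrix_vector_mult_diff_rdistrib)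
  moreover have "vdot w x = 1" using w k by simp
  ultimately show thesis using that by blast
qed

text \<open>If \<open>y\<^sup>H x = 0\<close>, then \<open>y\<close> would be a left null vector of the invertible bordered matrix.\<close>

lemma vdot_eigenvectors_nonzero:
  assumes "simple_eigenvalue M mu" "M *v x = mu *s x" "x \<noteq> 0"
    and "ctrans M *v y = cnj mu *s y" "y \<noteq> 0"
  shows "vdot y x \<noteq> 0"
proof
  assume 0: "vdot y x = 0"
  obtain w where w: "invertible (M - mat mu + outer x w)"
    using bordered_matrix_invertible assms(1-3) by metis
  have "ctrans (M - mat mu + outer x w) *v y = vdot x y *s w"
    by (simp add: ctrans_add ctrans_diff ctrans_mat ctrans_outer matrix_vector_mult_add_rdistrib
        matrix_vector_mult_diff_rdistrib mat_mult_vec outer_mult_vec assms(4))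
  also have "vdot x y = 0" using 0 cnj_vdot[of y x] by simp
  finally show False
    using ctrans_invertible[OF w] assms(5) by (simp add: invertible_iff_kernel)
qed

lemma group_inverse_eqI:
  assumes "M ** G = G ** M" "G ** M ** G = G" "M ** G ** M = M"
  shows "group_inverse M = G"
  unfolding group_inverse_def
proof (rule the_equality)
  fix G' assume G': "M ** G' = G' ** M \<and> G' ** M ** G' = G' \<and> M ** G' ** M = M"
  have "G ** M = G ** (M ** G' ** M)" using G' by metis
  also have "\<dots> = (M ** G ** M) ** G'" using G' assms(1) by (metis matrix_mul_assoc)
  finally have e: "G ** M = M ** G'" using assms(3) by simp
  have "G' = M ** G' ** G'" using G' by metis
  also have "\<dots> = G ** (M ** G')" using e by (simp add: matrix_mul_assoc)
  also have "\<dots> = G ** (M ** G)" using e assms(1) by simp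
  finally show "G' = G" using assms(2) by (simp add: matrix_mul_assoc)
qed (use assms in simp)

text \<open>With the spectral projection \<open>P = x y\<^sup>H / (y\<^sup>H x)\<close>, which satisfies \<open>N P = P N = 0\<close>, the matrix
  \<open>N + P\<close> is invertible and \<open>(N + P)\<^bsup>-1\<^esup> - P\<close> is the group inverse of \<open>N\<close>.\<close>

lemma group_inverse_simple_eigenvalue:
  assumes simple: "simple_eigenvalue M mu" and x: "M *v x = mu *s x" "x \<noteq> 0"
    and y: "ctrans M *v y = cnj mu *s y" "y \<noteq> 0"
  defines "G \<equiv> group_inverse (M - mat mu)" and "P \<equiv> outer x ((1 / cnj (vdot y x)) *s y)"
  shows "G ** (M - mat mu) = mat 1 - P" "(M - mat mu) ** G = mat 1 - P" "G ** P = 0" "P ** G = 0"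
proof -
  define N where "N = M - mat mu"
  define w where "w = (1 / cnj (vdot y x)) *s y"
  have c: "vdot y x \<noteq> 0" using vdot_eigenvectors_nonzero assms by blast
  have Nx: "N *v x = 0" by (simp add: N_def matrix_vector_mult_diff_rdistrib mat_mult_vec x)
  have Nw: "ctrans N *v w = 0"
    by (simp add: N_def w_def ctrans_diff ctrans_mat matrix_vector_mult_diff_rdistrib
      mat_mult_vec y vector_scalar_commute)
  have wx: "vdot w x = 1" using c by (simp add: w_def vdot_scale_left)
  have P: "P = outer x w" by (simp add: P_def w_def)
  have NP: "N ** P = 0" by (simp add: P mult_outer Nx) (simp add: outer_def vec_eq_iff)
  have PN: "P ** N = 0" by (simp add: P outer_mult Nw) (simp add: outer_def vec_eq_iff)
  have PP: "P ** P = P" by (simp add: P mult_outer outer_mult_vec wx)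
  have "invertible (N + P)"
    unfolding invertible_iff_kernel
  proof (intro allI impI)
    fix v assume v: "(N + P) *v v = 0"
    have "P *v v = (P ** (N + P)) *v v" by (simp add: matrix_add_ldistrib PN PP)
    also have "\<dots> = 0" by (simp add: v flip: matrix_vector_mul_assoc)
    finally have Pv: "P *v v = 0" .
    with v have Nv: "N *v v = 0" by (simp add: matrix_vector_mult_add_rdistrib)
    \<comment> \<open>invertibility of the bordered matrix forces the kernel of \<open>N\<close> to be spanned by \<open>x\<close>\<close>
    obtain b where b: "vdot b x = 1" "invertible (N + outer x b)"
      using bordered_matrix_invertible[OF simple x] by (metis N_def)
    have "(N + outer x b) *v (v - vdot b v *s x) = 0"
      by (simp add: matrix_vector_mult_add_rdistrib matrix_vector_mult_diff_distrib
        vector_scalar_commute Nv Nx outer_mult_vec b)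
    then have "v - vdot b v *s x = 0" using b(2)[unfolded invertible_iff_kernel] by blast
    then have vx: "v = vdot b v *s x" by simp
    have "vdot w v = 0" using Pv x(2) by (simp add: P outer_mult_vec)
    then have "vdot b v = 0" by (metis vx wx vdot_scale_right mult_cancel_left2 mult_zero_left)
    with vx show "v = 0" by simp
  qed
  then obtain K where K: "(N + P) ** K = mat 1" "K ** (N + P) = mat 1" by (auto simp: invertible_def)
  have KP: "K ** P = P"
  proof -
    have "K ** P = K ** ((N + P) ** P)" by (simp add: matrix_add_rdistrib NP PP)
    then show ?thesis by (simp add: matrix_mul_assoc K)
  qed
  have PK: "P ** K = P"
  proof -
    have "P ** K = (P ** (N + P)) ** K" by (simp add: matrix_add_ldistrib PN PP)
    then show ?thesis by (simp add: K flip: matrix_mul_assoc)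
  qed
  have NG: "N ** (K - P) = mat 1 - P"
    using K(1) by (simp add: matrix_diff_ldistrib matrix_add_rdistrib NP PK eq_diff_eq)
  have GN: "(K - P) ** N = mat 1 - P"
    using K(2) by (simp add: matrix_diff_rdistrib matrix_add_ldistrib PN KP eq_diff_eq)
  have GP: "(K - P) ** P = 0" by (simp add: matrix_diff_rdistrib KP PP)
  have PG: "P ** (K - P) = 0" by (simp add: matrix_diff_ldistrib PK PP)
  have "group_inverse N = K - P"
  proof (rule group_inverse_eqI)
    show "N ** (K - P) = (K - P) ** N" by (simp add: NG GN)
    show "(K - P) ** N ** (K - P) = K - P"
      unfolding GN by (simp add: matrix_diff_rdistrib PG)
    show "N ** (K - P) ** N = N" unfolding NG by (simp add: matrix_diff_rdistrib PN)
  qed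
  then show "G ** (M - mat mu) = mat 1 - P" "(M - mat mu) ** G = mat 1 - P" "G ** P = 0" "P ** G = 0"
    using NG GN GP PG by (simp_all add: G_def N_def)
qed

section \<open>Continuity of the eigenvalue\<close>

lemma bounded_bilinear_vec_scale:
  "bounded_bilinear ((*s) :: complex \<Rightarrow> complex^'n \<Rightarrow> complex^'n)"
  unfolding bilinear_conv_bounded_bilinear[symmetric] bilinear_def linear_iff
  by (simp add: vec_eq_iff algebra_simps)

lemma simple_eigenvalue_left_eigenvector:
  assumes "simple_eigenvalue M mu"
  obtains v where "norm v = 1" "ctrans M *v v = cnj mu *s v"
proof -
  have "\<not> invertible (M - mat mu)"
    using simple_eigenvalue_eigenvector[OF assms]
    by (metis eq_iff_diff_eq_0 invertible_iff_kernel mat_mult_vec matrix_vector_mult_diff_rdistrib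
        norm_zero zero_neq_one)
  then have "\<not> invertible (ctrans (M - mat mu))"
    using ctrans_invertible[of "ctrans (M - mat mu)"] by auto
  then obtain v where v: "v \<noteq> 0" "ctrans M *v v = cnj mu *s v"
    by (auto simp: invertible_iff_kernel ctrans_diff ctrans_mat matrix_vector_mult_diff_rdistrib mat_mult_vec)
  show thesis
  proof
    show "norm ((1 / norm v) *s v) = 1" using v(1) by (simp add: norm_vec_scale norm_divide)
    show "ctrans M *v ((1 / norm v) *s v) = cnj mu *s ((1 / norm v) *s v)"
      using v(2) by (simp add: vector_scalar_commute vector_smult_assoc mult.commute)
  qed
qed

text \<open>The form in which compactness is used below: \<open>F p = 0\<close> says that some eigenvector equations hold, and
  \<open>g p\<close> is a distance that they force to be positive.\<close>

lemma positive_on_zero_set_bounded_below: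
  fixes F :: "'a::metric_space \<Rightarrow> 'b::real_normed_vector" and g :: "'a \<Rightarrow> real"
  assumes "compact B" "continuous_on B F" "continuous_on B g"
    and pos: "\<And>p. p \<in> B \<Longrightarrow> F p = 0 \<Longrightarrow> g p > 0"
  obtains d where "d > 0" "\<forall>p\<in>B. F p = 0 \<longrightarrow> d \<le> g p"
proof (cases "{p \<in> B. F p = 0} = {}")
  case True
  then show thesis using that[of 1] by auto
next
  case False
  have "closed {p \<in> B. F p = 0}"
    by (intro continuous_closed_preimage_constant assms compact_imp_closed)
  then have "compact (B \<inter> {p \<in> B. F p = 0})"
    using assms(1) by (rule compact_Int_closed[rotated])
  moreover have "B \<inter> {p \<in> B. F p = 0} = {p \<in> B. F p = 0}" by blast
  ultimately obtain q where q: "q \<in> B" "F q = 0" "\<And>p. p \<in> B \<Longrightarrow> F p = 0 \<Longrightarrow> g q \<le> g p"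
    using continuous_attains_inf[of "{p \<in> B. F p = 0}" g] False
      continuous_on_subset[OF assms(3), of "{p \<in> B. F p = 0}"] by auto
  then show thesis using that[of "g q"] pos by blast
qed

lemma unit_sphere_eq: "unit_sphere = sphere 0 1"
  by (auto simp: unit_sphere_def frob_norm_eq)

text \<open>A right eigenvector for an eigenvalue \<open>z \<noteq> l t\<close> is orthogonal to the left eigenvectors for \<open>l t\<close>. On the
  compact set of all \<open>t\<close>, \<open>z\<close> near \<open>l t\<close> and unit eigenvectors \<open>u\<close> for \<open>z\<close>, \<open>v\<close> for \<open>l t\<close> with
  \<open>v\<^sup>H u = 0\<close>, the value \<open>z = l t\<close> does not occur, because \<open>v\<^sup>H u \<noteq> 0\<close> for a simple eigenvalue. So
  \<open>|z - l t|\<close> has a positive minimum there.\<close>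

lemma simple_branch_isolated:
  fixes A E :: "complex^'n^'n"
  assumes cont: "continuous_on {0..e} l"
    and simple: "\<And>t. t \<in> {0..e} \<Longrightarrow> simple_eigenvalue (A + t *\<^sub>R E) (l t)"
  obtains r where "r > 0" "\<And>t z v. t \<in> {0..e} \<Longrightarrow> (A + t *\<^sub>R E) *v v = z *s v \<Longrightarrow> v \<noteq> 0
    \<Longrightarrow> z \<noteq> l t \<Longrightarrow> r \<le> cmod (z - l t)"
proof -
  \<comment> \<open>the second component of a point of \<open>B\<close> is the difference \<open>z - l t\<close>\<close>
  define B :: "(real \<times> complex \<times> (complex^'n) \<times> (complex^'n)) set"
    where "B = {0..e} \<times> cball 0 1 \<times> sphere 0 1 \<times> sphere 0 1"
  define F where "F = (\<lambda>(t, z, u, v).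
      ((A + t *\<^sub>R E) *v u - (l t + z) *s u, ctrans (A + t *\<^sub>R E) *v v - cnj (l t) *s v, vdot v u))"
  have l: "continuous_on B (\<lambda>p. l (fst p))"
    by (rule continuous_on_compose2[OF cont]) (auto simp: B_def intro: continuous_intros)
  have "compact B" unfolding B_def by (intro compact_Times) auto
  moreover have "continuous_on B F"
    unfolding F_def split_def
    by (intro continuous_intros mv.continuous_on vd.continuous_on l
        bounded_bilinear.continuous_on[OF bounded_bilinear_vec_scale]
        bounded_linear.continuous_on[OF bounded_linear_ctrans])
  moreover have "continuous_on B (\<lambda>p. cmod (fst (snd p)))" by (intro continuous_intros)
  moreover have "cmod (fst (snd p)) > 0" if "p \<in> B" "F p = 0" for p
  proof -
    obtain t z u v where p: "p = (t, z, u, v)" by (metis surj_pair)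
    have t: "t \<in> {0..e}" "u \<noteq> 0" "v \<noteq> 0" using that(1) by (auto simp: p B_def)
    have z: "(A + t *\<^sub>R E) *v u = (l t + z) *s u" "ctrans (A + t *\<^sub>R E) *v v = cnj (l t) *s v" "vdot v u = 0"
      using that(2) by (auto simp: p F_def zero_prod_def)
    have "z \<noteq> 0" using vdot_eigenvectors_nonzero[OF simple[OF t(1)]] z t by force
    then show ?thesis by (simp add: p)
  qed
  ultimately obtain d where d: "d > 0" "\<forall>p\<in>B. F p = 0 \<longrightarrow> d \<le> cmod (fst (snd p))"
    by (rule positive_on_zero_set_bounded_below) blast
  show thesis
  proof
    show "min 1 d > 0" using d(1) by simp
  next
    fix t z u assume t: "t \<in> {0..e}" and u: "(A + t *\<^sub>R E) *v u = z *s u" "u \<noteq> 0" and z: "z \<noteq> l t"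
    show "min 1 d \<le> cmod (z - l t)"
    proof (rule ccontr)
      assume small: "\<not> ?thesis"
      obtain v where v: "norm v = 1" "ctrans (A + t *\<^sub>R E) *v v = cnj (l t) *s v"
        using simple_eigenvalue_left_eigenvector simple[OF t] by metis
      define u' where "u' = (1 / norm u) *s u"
      have u': "norm u' = 1" "(A + t *\<^sub>R E) *v u' = z *s u'"
        using u by (simp_all add: u'_def norm_vec_scale norm_divide vector_scalar_commute
            vector_smult_assoc mult.commute)
      have "z * vdot v u' = l t * vdot v u'"
        using vdot_matrix[of v "A + t *\<^sub>R E" u'] by (simp add: u' v vdot_scale_left vdot_scale_right)
      then have "vdot v u' = 0" using z by simp
      then have "F (t, z - l t, u', v) = 0" by (simp add: F_def u' v zero_prod_def)
      moreover have "(t, z - l t, u', v) \<in> B" using t small u' v by (simp add: B_def)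
      ultimately have "d \<le> cmod (z - l t)" using d(2) by fastforce
      with small show False by simp
    qed
  qed
qed

text \<open>The tube argument described at the beginning. Let \<open>s\<close> be smaller than the isolation radius of the branch
  of \<open>E\<close>. If \<open>A + t F\<close> has an eigenvalue at distance exactly \<open>s\<close> from \<open>\<lambda>(t, E)\<close> for some \<open>t\<close>, then \<open>F \<noteq> E\<close>,
  and by compactness \<open>F\<close> keeps a positive distance \<open>d\<close> from \<open>E\<close>. For \<open>F\<close> closer than \<open>d\<close> the continuous
  function \<open>t \<mapsto> |\<lambda>(t, F) - \<lambda>(t, E)|\<close> starts at \<open>0\<close> and omits the value \<open>s\<close>, so it stays below \<open>s\<close>.\<close>

lemma simple_continuation_tendsto:
  fixes A E :: "complex^'n^'n"
  assumes sc: "simple_continuation A lam0 eps0 lam" and e: "0 \<le> \<epsilon>" "\<epsilon> \<le> eps0"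
    and E: "E \<in> unit_sphere"
  shows "(lam \<epsilon> \<longlongrightarrow> lam \<epsilon> E) (at E within unit_sphere)"
proof (rule tendstoI)
  fix r :: real assume r: "r > 0"
  have cont: "continuous_on {0..\<epsilon>} (\<lambda>t. lam t F)" if "F \<in> unit_sphere" for F
    using sc that e unfolding simple_continuation_def by (auto intro: continuous_on_subset)
  have simple: "simple_eigenvalue (A + t *\<^sub>R F) (lam t F)" if "F \<in> unit_sphere" "t \<in> {0..\<epsilon>}" for F t
    using sc that e unfolding simple_continuation_def by auto
  have init: "lam 0 F = lam0" if "F \<in> unit_sphere" for F
    using sc that unfolding simple_continuation_def by auto
  obtain r1 where r1: "r1 > 0" "\<And>t z v. t \<in> {0..\<epsilon>} \<Longrightarrow> (A + t *\<^sub>R E) *v v = z *s v \<Longrightarrow> v \<noteq> 0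
    \<Longrightarrow> z \<noteq> lam t E \<Longrightarrow> r1 \<le> cmod (z - lam t E)"
    using simple_branch_isolated[OF cont[OF E] simple[OF E]] by metis
  define s where "s = min r r1 / 2"
  have s: "0 < s" "s < r" "s < r1" using r r1(1) by (auto simp: s_def)
  define B where "B = {0..\<epsilon>} \<times> sphere (0::complex) s \<times> (unit_sphere :: (complex^'n^'n) set) \<times> sphere (0 :: complex^'n) 1"
  define Q where "Q = (\<lambda>(t, w, F :: complex^'n^'n, u). (A + t *\<^sub>R F) *v u - (lam t E + w) *s u)"
  have l: "continuous_on B (\<lambda>p. lam (fst p) E)"
    by (rule continuous_on_compose2[OF cont[OF E]]) (auto simp: B_def intro: continuous_intros)
  have "compact B" unfolding B_def unit_sphere_eq by (intro compact_Times) auto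
  moreover have "continuous_on B Q"
    unfolding Q_def split_def
    by (intro continuous_intros mv.continuous_on l
        bounded_bilinear.continuous_on[OF bounded_bilinear_vec_scale])
  moreover have "continuous_on B (\<lambda>p. norm (fst (snd (snd p)) - E))" by (intro continuous_intros)
  moreover have "norm (fst (snd (snd p)) - E) > 0" if "p \<in> B" "Q p = 0" for p
  proof -
    obtain t w F u where p: "p = (t, w, F, u)" by (metis surj_pair)
    have "F \<noteq> E"
    proof
      assume "F = E"
      then have "(A + t *\<^sub>R E) *v u = (lam t E + w) *s u" "t \<in> {0..\<epsilon>}" "u \<noteq> 0" "cmod w = s"
        using that by (auto simp: p B_def Q_def)
      then show False using r1(2)[of t u "lam t E + w"] s by force
    qed
    then show ?thesis by (simp add: p)
  qed
  ultimately obtain d where d: "d > 0" "\<forall>p\<in>B. Q p = 0 \<longrightarrow> d \<le> norm (fst (snd (snd p)) - E)"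
    by (rule positive_on_zero_set_bounded_below) blast
  have "dist (lam \<epsilon> F) (lam \<epsilon> E) < r" if F: "F \<in> unit_sphere" "dist F E < d" for F
  proof (rule ccontr)
    assume "\<not> dist (lam \<epsilon> F) (lam \<epsilon> E) < r"
    then have "s \<le> cmod (lam \<epsilon> F - lam \<epsilon> E)" using s by (simp add: dist_norm)
    moreover have "cmod (lam 0 F - lam 0 E) \<le> s" using s by (simp add: init E F)
    moreover have "continuous_on {0..\<epsilon>} (\<lambda>t. cmod (lam t F - lam t E))"
      by (intro continuous_intros cont E F)
    ultimately obtain t where t: "0 \<le> t" "t \<le> \<epsilon>" "cmod (lam t F - lam t E) = s"
      using IVT'[of "\<lambda>t. cmod (lam t F - lam t E)" 0 s \<epsilon>] e by auto
    obtain v where "norm v = 1" "(A + t *\<^sub>R F) *v v = lam t F *s v"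
      using simple_eigenvalue_eigenvector[OF simple[OF F(1), of t]] t by auto
    then have "Q (t, lam t F - lam t E, F, v) = 0" "(t, lam t F - lam t E, F, v) \<in> B"
      using t F by (auto simp: Q_def B_def)
    then have "d \<le> norm (F - E)" using d(2) by fastforce
    then show False using F(2) by (simp add: dist_norm)
  qed
  then show "\<forall>\<^sub>F F in at E within unit_sphere. dist (lam \<epsilon> F) (lam \<epsilon> E) < r"
    unfolding eventually_at using d(1) by blast
qed

section \<open>First-order perturbation of eigenvectors\<close>

text \<open>Let \<open>N\<close> be the shifted matrix at \<open>E\<close> and \<open>\<Delta>\<close> its increment \<open>L (F - E) - (\<mu> F - \<mu> E) I\<close>. Multiplying
  \<open>N X = - \<Delta> X\<close> by \<open>G\<close> and dividing by \<open>w\<^sup>H X\<close> yields \<open>u - x\<^sub>0 = - G \<Delta> u\<close> for the eigenvector \<open>u\<close>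
  with \<open>w\<^sup>H u = 1\<close>. Since \<open>G x\<^sub>0 = 0\<close>, the multiple of the identity in \<open>\<Delta>\<close> does not act on \<open>x\<^sub>0\<close>:
  \<open>u - x\<^sub>0 = - G L(F - E) x\<^sub>0 - G \<Delta> (u - x\<^sub>0)\<close>. The last term is of smaller order as soon as \<open>\<Delta>\<close> tends to
  zero, that is, as soon as \<open>\<mu>\<close> is continuous at \<open>E\<close>.

  \<open>L\<close> is a general linear map so that the lemma covers both \<open>F \<mapsto> \<epsilon> F\<close> and \<open>F \<mapsto> \<epsilon> F\<^sup>H\<close>, the latter for the
  left eigenvectors.\<close>

lemma normalised_eigenvector_has_derivative:
  fixes A :: "complex^'n^'n" and L :: "'e::real_normed_vector \<Rightarrow> complex^'n^'n"
  assumes L: "bounded_linear L"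
    and eig: "\<And>F. F \<in> D \<Longrightarrow> (A + L F) *v X F = mu F *s X F" "\<And>F. F \<in> D \<Longrightarrow> X F \<noteq> 0"
    and mu: "(mu \<longlongrightarrow> mu E) (at E within D)"
    and G: "G ** (A + L E - mat (mu E)) = mat 1 - outer (X E) w" "G *v X E = 0" "vdot w (X E) = 1"
  shows "\<forall>\<^sub>F F in at E within D. vdot w (X F) \<noteq> 0"
    and "((\<lambda>F. (1 / vdot w (X F)) *s X F) has_derivative (\<lambda>H. - (G *v (L H *v X E)))) (at E within D)"
proof -
  define x0 where "x0 = X E"
  define \<Delta> where "\<Delta> F = L (F - E) - mat (mu F - mu E)" for F
  obtain k where k: "\<And>v. norm (G *v v) \<le> norm v * k" "k > 0"
    using mv.bounded_linear_right[THEN bounded_linear.pos_bounded, of G] by blast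
  obtain K where K: "\<And>(M :: complex^'n^'n) v. norm (M *v v) \<le> norm M * norm v * K" "K > 0"
    using mv.pos_bounded by blast
  have "bounded_linear (\<lambda>H. L H *v x0)"
    using bounded_linear_compose[OF mv.bounded_linear_left L] by (simp add: o_def)
  then obtain C where C: "\<And>H. norm (L H *v x0) \<le> norm H * C" "C > 0"
    using bounded_linear.pos_bounded by blast
  \<comment> \<open>\<open>b F\<close> bounds the operator norm of \<open>G \<Delta>\<close>\<close>
  define b where "b F = (norm (L (F - E)) * K + cmod (mu F - mu E)) * k" for F
  have b0: "(b \<longlongrightarrow> 0) (at E within D)"
  proof -
    have "((\<lambda>F. L (F - E)) \<longlongrightarrow> L (E - E)) (at E within D)"
      by (intro bounded_linear.tendsto[OF L] tendsto_intros)
    then have "((\<lambda>F. L (F - E)) \<longlongrightarrow> 0) (at E within D)" using linear_0[OF bounded_linear.linear[OF L]] by simp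
    moreover have "((\<lambda>F. mu F - mu E) \<longlongrightarrow> 0) (at E within D)" using mu by (simp add: LIM_zero)
    ultimately have "(b \<longlongrightarrow> (norm (0 :: complex^'n^'n) * K + cmod 0) * k) (at E within D)"
      unfolding b_def by (intro tendsto_intros)
    then show ?thesis by simp
  qed
  have GD: "norm (G *v (\<Delta> F *v v)) \<le> b F * norm v" for F v
  proof -
    have "norm (\<Delta> F *v v) \<le> norm (L (F - E) *v v) + norm ((mu F - mu E) *s v)"
      unfolding \<Delta>_def matrix_vector_mult_diff_rdistrib mat_mult_vec by (rule norm_triangle_ineq4)
    also have "\<dots> \<le> norm (L (F - E)) * norm v * K + cmod (mu F - mu E) * norm v"
      unfolding norm_vec_scale using K(1)[of "L (F - E)" v] by simp
    finally have "norm (\<Delta> F *v v) * k \<le> (norm (L (F - E)) * norm v * K + cmod (mu F - mu E) * norm v) * k"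
      using k(2) by simp
    then show ?thesis using k(1)[of "\<Delta> F *v v"] by (simp add: b_def algebra_simps)
  qed
  have res: "X F - vdot w (X F) *s x0 = - (G *v (\<Delta> F *v X F))" if "F \<in> D" for F
  proof -
    have "(A + L E - mat (mu E)) *v X F + \<Delta> F *v X F = (A + L F - mat (mu F)) *v X F"
      by (simp add: \<Delta>_def linear_diff[OF bounded_linear.linear[OF L]] matrix_vector_mult_diff_rdistrib
          matrix_vector_mult_add_rdistrib mat_mult_vec vec.scale_left_diff_distrib)
    also have "\<dots> = 0"
      using eig(1)[OF that] by (simp add: matrix_vector_mult_diff_rdistrib mat_mult_vec)
    finally have "(A + L E - mat (mu E)) *v X F = - (\<Delta> F *v X F)" by (simp add: add_eq_0_iff2)
    then have "(G ** (A + L E - mat (mu E))) *v X F = G *v (- (\<Delta> F *v X F))"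
      by (simp flip: matrix_vector_mul_assoc)
    then show ?thesis
      by (simp add: G matrix_vector_mult_diff_rdistrib outer_mult_vec x0_def vec.neg)
  qed
  have nz: "vdot w (X F) \<noteq> 0" if "F \<in> D" "b F < 1/2" for F
  proof
    assume "vdot w (X F) = 0"
    then have "norm (X F) \<le> b F * norm (X F)" using GD[of F "X F"] res[OF that(1)]
      by (metis diff_zero norm_minus_cancel vec.scale_zero_left)
    also have "\<dots> < norm (X F)" using that eig(2)[OF that(1)] by simp
    finally show False by simp
  qed
  have small: "\<forall>\<^sub>F F in at E within D. b F < 1/2" using b0 by (rule order_tendstoD) simp
  then show "\<forall>\<^sub>F F in at E within D. vdot w (X F) \<noteq> 0"
    using nz unfolding eventually_at_filter by (auto elim!: eventually_mono)
  obtain d where d: "d > 0" "\<And>F. F \<in> D \<Longrightarrow> F \<noteq> E \<Longrightarrow> dist F E < d \<Longrightarrow> b F < 1/2"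
    using small unfolding eventually_at by blast
  define u where "u F = (1 / vdot w (X F)) *s X F" for F
  have "(u has_derivative (\<lambda>H. - (G *v (L H *v x0)))) (at E within D)"
  proof (rule has_derivativeI_sandwich[OF d(1)])
    show "bounded_linear (\<lambda>H. - (G *v (L H *v x0)))"
      by (intro bounded_linear_minus bounded_linear_compose[OF mv.bounded_linear_right]
          bounded_linear_compose[OF mv.bounded_linear_left] L)
    show "((\<lambda>F. b F * (2 * C * k)) \<longlongrightarrow> 0) (at E within D)"
      using tendsto_mult_left_zero[OF b0] by simp
    fix F assume F: "F \<in> D" "F \<noteq> E" "dist F E < d"
    have bF: "b F < 1/2" using d F by blast
    have w: "vdot w (X F) \<noteq> 0" using nz F bF by blast
    \<comment> \<open>the implicit equation \<open>u - x\<^sub>0 = - G \<Delta> u\<close> and its consequence \<open>\<parallel>u - x\<^sub>0\<parallel> = O(\<parallel>F - E\<parallel>)\<close>\<close>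
    have "u F - x0 = (1 / vdot w (X F)) *s (X F - vdot w (X F) *s x0)"
      using w by (simp add: u_def vec.scale_right_diff_distrib vector_smult_assoc)
    also have "\<dots> = - (G *v (\<Delta> F *v u F))"
      by (simp add: res[OF F(1)] u_def vector_scalar_commute)
    finally have u: "u F - x0 = - (G *v (\<Delta> F *v u F))" .
    have "G *v (\<Delta> F *v x0) = G *v (L (F - E) *v x0)"
      using G(2) by (simp add: \<Delta>_def matrix_vector_mult_diff_rdistrib mat_mult_vec
          matrix_vector_mult_diff_distrib vector_scalar_commute x0_def)
    then have "G *v (\<Delta> F *v u F) = G *v (L (F - E) *v x0) + G *v (\<Delta> F *v (u F - x0))"
      by (simp add: matrix_vector_mult_diff_distrib)
    moreover have "p = - (a + b) \<Longrightarrow> p - - a = - b" for p a b :: "complex^'n" by simp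
    ultimately have rem: "u F - x0 - - (G *v (L (F - E) *v x0)) = - (G *v (\<Delta> F *v (u F - x0)))"
      using u by metis
    have "norm (u F - x0) \<le> norm (G *v (L (F - E) *v x0)) + norm (G *v (\<Delta> F *v (u F - x0)))"
    proof -
      have "norm p \<le> norm a + norm b" if "p - - a = - b" for p a b :: "complex^'n"
      proof -
        have "p = (p - - a) - a" by simp
        also have "\<dots> = - b - a" using that by simp
        finally show ?thesis using norm_triangle_ineq4[of "- b" a] by simp
      qed
      from this[OF rem] show ?thesis .
    qed
    also have "norm (G *v (L (F - E) *v x0)) \<le> norm (F - E) * C * k"
      by (rule order_trans[OF k(1) mult_right_mono[OF C(1)]]) (use k(2) in simp)
    also have "norm (G *v (\<Delta> F *v (u F - x0))) \<le> b F * norm (u F - x0)" by (rule GD)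
    also have "b F * norm (u F - x0) \<le> 1/2 * norm (u F - x0)" using bF by (intro mult_right_mono) auto
    finally have "norm (u F - x0) \<le> norm (F - E) * (2 * C * k)" by simp
    moreover have "b F \<ge> 0" using K(2) k(2) by (simp add: b_def)
    ultimately have "b F * norm (u F - x0) \<le> b F * (norm (F - E) * (2 * C * k))"
      by (intro mult_left_mono)
    then have "norm (u F - x0 - - (G *v (L (F - E) *v x0))) \<le> b F * (norm (F - E) * (2 * C * k))"
      unfolding rem using GD[of F "u F - x0"] by simp
    moreover have "u E = x0" by (simp add: u_def G(3) x0_def)
    ultimately show "norm (u F - u E - - (G *v (L (F - E) *v x0))) / norm (F - E) \<le> b F * (2 * C * k)"
      using F(2) by (simp add: divide_le_eq mult_ac)
  qed
  then show "((\<lambda>F. (1 / vdot w (X F)) *s X F) has_derivative (\<lambda>H. - (G *v (L H *v X E)))) (at E within D)"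
    by (simp add: u_def[abs_def] x0_def)
qed

text \<open>The orthogonality assumptions make the numerator stationary, so the derivative comes from the
  denominator alone.\<close>

lemma has_derivative_normalised_overlap:
  fixes u v :: "'e::real_normed_vector \<Rightarrow> complex^'n"
  assumes u: "(u has_derivative u') (at E within D)" "norm (u E) = 1" "\<And>H. vdot (v E) (u' H) = 0"
    and v: "(v has_derivative v') (at E within D)" "norm (v E) = 1" "\<And>H. vdot (v' H) (u E) = 0"
    and nz: "vdot (v E) (u E) \<noteq> 0"
  shows "((\<lambda>F. cmod (vdot (v F) (u F)) / (norm (v F) * norm (u F))) has_derivative
    (\<lambda>H. - cmod (vdot (v E) (u E)) * (inner (v E) (v' H) + inner (u E) (u' H)))) (at E within D)"
proof -
  have un: "u E \<noteq> 0" "v E \<noteq> 0" using u(2) v(2) by auto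
  have q: "((\<lambda>F. vdot (v F) (u F)) has_derivative (\<lambda>H. 0)) (at E within D)"
    using vd.FDERIV[OF v(1) u(1)] by (simp add: u(3) v(3))
  have p: "((\<lambda>F. cmod (vdot (v F) (u F))) has_derivative (\<lambda>H. 0)) (at E within D)"
    using has_derivative_compose[OF q has_derivative_norm[OF nz]] by simp
  have nu: "((\<lambda>F. norm (u F)) has_derivative (\<lambda>H. inner (u E) (u' H))) (at E within D)"
    using has_derivative_compose[OF u(1) has_derivative_norm[OF un(1)]]
    by (simp add: sgn_div_norm u(2) inner_commute)
  have nv: "((\<lambda>F. norm (v F)) has_derivative (\<lambda>H. inner (v E) (v' H))) (at E within D)"
    using has_derivative_compose[OF v(1) has_derivative_norm[OF un(2)]]
    by (simp add: sgn_div_norm v(2) inner_commute)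
  show ?thesis
    using has_derivative_divide'[OF p has_derivative_mult[OF nv nu]]
    by (simp add: u(2) v(2) algebra_simps)
qed

text \<open>With \<open>u\<close>, \<open>v\<close> the rescaled eigenvectors, \<open>f\<close> is the normalised overlap of \<open>v\<close> and \<open>u\<close>; the norms
  contribute to \<open>f' / (\<epsilon> f)\<close> the terms \<open>Re (x\<^sup>H G H x)\<close> and \<open>Re (y\<^sup>H H G y)\<close>, which are the inner products of \<open>H\<close> with the two rank-one
  summands \<open>G\<^sup>H x x\<^sup>H\<close> and \<open>y y\<^sup>H G\<^sup>H\<close> of \<open>S\<close>.\<close>

lemma eigenvalue_condition_has_derivative:
  fixes A :: "complex^'n^'n" and \<epsilon> :: real
  assumes E: "E \<in> D" and simple: "simple_eigenvalue (A + \<epsilon> *\<^sub>R E) (mu E)"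
    and ev: "\<And>F. F \<in> D \<Longrightarrow> unit_eigenvectors (A + \<epsilon> *\<^sub>R F) (mu F) (x F) (y F)"
    and mu: "(mu \<longlongrightarrow> mu E) (at E within D)"
  shows "vdot (y E) (x E) \<noteq> 0"
    and "((\<lambda>F. cmod (vdot (y F) (x F))) has_derivative
      (\<lambda>H. \<epsilon> * cmod (vdot (y E) (x E)) * inner (S_matrix (A + \<epsilon> *\<^sub>R E) (mu E) (x E) (y E)) H))
      (at E within D)"
proof -
  define c where "c = vdot (y E) (x E)"
  define N where "N = A + \<epsilon> *\<^sub>R E - mat (mu E)"
  define G where "G = group_inverse N"
  \<comment> \<open>with these functionals \<open>x w\<^sup>H\<close> and \<open>y z\<^sup>H\<close> are the spectral projection and its adjoint\<close>
  define w where "w = (1 / cnj c) *s y E"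
  define z where "z = (1 / c) *s x E"
  have x: "(A + \<epsilon> *\<^sub>R F) *v x F = mu F *s x F" "norm (x F) = 1"
    and y: "ctrans (A + \<epsilon> *\<^sub>R F) *v y F = cnj (mu F) *s y F" "norm (y F) = 1" if "F \<in> D" for F
    using ev[OF that] by (auto simp: unit_eigenvectors_def left_eigenvector_iff)
  have xy0: "x F \<noteq> 0" "y F \<noteq> 0" if "F \<in> D" for F using x(2)[OF that] y(2)[OF that] by auto
  show nz: "vdot (y E) (x E) \<noteq> 0"
    by (rule vdot_eigenvectors_nonzero[OF simple x(1) _ y(1)]) (use E xy0 in auto)
  have c: "c \<noteq> 0" using nz by (simp add: c_def)
  note gi = group_inverse_simple_eigenvalue[OF simple x(1)[OF E] xy0(1)[OF E] y(1)[OF E] xy0(2)[OF E],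
      folded N_def c_def, folded G_def w_def]
  have out0: "a = 0" if "outer a b = 0" "b \<noteq> 0" for a b :: "complex^'n"
    using that by (auto simp: outer_def vec_eq_iff)
  have "outer (G *v x E) w = 0" using gi(3) by (simp add: mult_outer)
  then have Gx: "G *v x E = 0" using out0 c xy0(2)[OF E] by (force simp: w_def)
  have "outer (x E) (ctrans G *v w) = 0" using gi(4) by (simp add: outer_mult)
  then have "outer (ctrans G *v w) (x E) = 0"
    by (metis ctrans_outer ctrans_scaleR scaleR_zero_left)
  then have "ctrans G *v w = 0" using out0 xy0(1)[OF E] by blast
  then have Gy: "ctrans G *v y E = 0" using c by (simp add: w_def vector_scalar_commute)
  have wx: "vdot w (x E) = 1" using c by (simp add: w_def vdot_scale_left c_def)
  have zy: "vdot z (y E) = 1"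
  proof -
    have "vdot (x E) (y E) = cnj c" by (simp add: c_def cnj_vdot)
    then show ?thesis using c by (simp add: z_def vdot_scale_left)
  qed
  have Ly: "bounded_linear (\<lambda>F :: complex^'n^'n. \<epsilon> *\<^sub>R F)" by (rule bounded_linear_scaleR_right)
  have Lz: "bounded_linear (\<lambda>F :: complex^'n^'n. ctrans (\<epsilon> *\<^sub>R F))"
    by (rule bounded_linear_compose[OF bounded_linear_ctrans Ly])
  have G1: "G ** (A + \<epsilon> *\<^sub>R E - mat (mu E)) = mat 1 - outer (x E) w" using gi(1) by (simp add: N_def)
  have G2: "ctrans G ** (ctrans A + ctrans (\<epsilon> *\<^sub>R E) - mat (cnj (mu E))) = mat 1 - outer (y E) z"
  proof -
    have "ctrans G ** (ctrans A + ctrans (\<epsilon> *\<^sub>R E) - mat (cnj (mu E))) = ctrans (N ** G)"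
      by (simp add: N_def ctrans_mult ctrans_add ctrans_diff ctrans_mat)
    also have "\<dots> = mat 1 - outer w (x E)" by (simp add: gi(2) ctrans_diff ctrans_outer)
    also have "outer w (x E) = outer (y E) z"
      by (simp add: w_def z_def outer_def vec_eq_iff)
    finally show ?thesis .
  qed
  define u where "u F = (1 / vdot w (x F)) *s x F" for F
  define v where "v F = (1 / vdot z (y F)) *s y F" for F
  have mu': "((\<lambda>F. cnj (mu F)) \<longlongrightarrow> cnj (mu E)) (at E within D)" using mu by (rule tendsto_cnj)
  have eigy: "(ctrans A + ctrans (\<epsilon> *\<^sub>R F)) *v y F = cnj (mu F) *s y F" if "F \<in> D" for F
    using y(1)[OF that] by (simp add: ctrans_add)
  have du: "\<forall>\<^sub>F F in at E within D. vdot w (x F) \<noteq> 0"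
      "(u has_derivative (\<lambda>H. - (G *v ((\<epsilon> *\<^sub>R H) *v x E)))) (at E within D)"
    unfolding u_def[abs_def]
    using normalised_eigenvector_has_derivative[OF Ly x(1) xy0(1) mu G1 Gx wx] by blast+
  have dv: "\<forall>\<^sub>F F in at E within D. vdot z (y F) \<noteq> 0"
      "(v has_derivative (\<lambda>H. - (ctrans G *v (ctrans (\<epsilon> *\<^sub>R H) *v y E)))) (at E within D)"
    unfolding v_def[abs_def]
    using normalised_eigenvector_has_derivative[OF Lz eigy xy0(2) mu' G2 Gy zy] by blast+
  have uE: "u E = x E" "v E = y E" using wx zy by (simp_all add: u_def v_def)
  have "vdot (y E) (- (G *v ((\<epsilon> *\<^sub>R H) *v x E))) = 0" for H
    by (simp add: vd.minus_right vdot_matrix[of _ G] Gy vd.zero_left)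
  moreover have "vdot (- (ctrans G *v (ctrans (\<epsilon> *\<^sub>R H) *v y E))) (x E) = 0" for H
    by (simp add: vd.minus_left Gx vd.zero_right flip: vdot_matrix[of _ G])
  ultimately have "((\<lambda>F. cmod (vdot (v F) (u F)) / (norm (v F) * norm (u F))) has_derivative
    (\<lambda>H. - cmod (vdot (y E) (x E)) * (inner (y E) (- (ctrans G *v (ctrans (\<epsilon> *\<^sub>R H) *v y E)))
      + inner (x E) (- (G *v ((\<epsilon> *\<^sub>R H) *v x E)))))) (at E within D)"
    using has_derivative_normalised_overlap[OF du(2) _ _ dv(2)] nz x(2)[OF E] y(2)[OF E] by (simp add: uE)
  moreover have "- cmod (vdot (y E) (x E)) * (inner (y E) (- (ctrans G *v (ctrans (\<epsilon> *\<^sub>R H) *v y E)))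
      + inner (x E) (- (G *v ((\<epsilon> *\<^sub>R H) *v x E))))
    = \<epsilon> * cmod (vdot (y E) (x E)) * inner (S_matrix (A + \<epsilon> *\<^sub>R E) (mu E) (x E) (y E)) H" for H
  proof -
    have "inner (y E) (ctrans G *v (ctrans (\<epsilon> *\<^sub>R H) *v y E)) = \<epsilon> * Re (vdot (y E) (H *v (G *v y E)))"
      by (simp add: inner_eq_Re_vdot ctrans_scaleR mv.scaleR_left mv.scaleR_right vd.scaleR_right
          vdot_matrix[of _ "ctrans G"] vdot_matrix[of _ "ctrans H"])
        (metis inner_eq_Re_vdot inner_commute)
    moreover have "inner (x E) (G *v ((\<epsilon> *\<^sub>R H) *v x E)) = \<epsilon> * Re (vdot (ctrans G *v x E) (H *v x E))"
      by (simp add: inner_eq_Re_vdot mv.scaleR_left mv.scaleR_right vd.scaleR_right vdot_matrix[of _ G])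
    moreover have "S_matrix (A + \<epsilon> *\<^sub>R E) (mu E) (x E) (y E)
        = outer (y E) (G *v y E) + outer (ctrans G *v x E) (x E)"
      by (simp add: S_matrix_def Let_def outer_mult mult_outer G_def N_def)
    ultimately show ?thesis by (simp add: inner_add_left inner_outer algebra_simps)
  qed
  ultimately have der: "((\<lambda>F. cmod (vdot (v F) (u F)) / (norm (v F) * norm (u F))) has_derivative
    (\<lambda>H. \<epsilon> * cmod (vdot (y E) (x E)) * inner (S_matrix (A + \<epsilon> *\<^sub>R E) (mu E) (x E) (y E)) H))
      (at E within D)" by simp
  have ratio: "cmod (vdot (v F) (u F)) / (norm (v F) * norm (u F)) = cmod (vdot (y F) (x F))"
    if "F \<in> D" "vdot w (x F) \<noteq> 0" "vdot z (y F) \<noteq> 0" for F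
    using that x(2)[of F] y(2)[of F]
    by (simp add: u_def v_def norm_vec_scale vdot_scale_left vdot_scale_right norm_mult norm_divide)
  show "((\<lambda>F. cmod (vdot (y F) (x F))) has_derivative
      (\<lambda>H. \<epsilon> * cmod (vdot (y E) (x E)) * inner (S_matrix (A + \<epsilon> *\<^sub>R E) (mu E) (x E) (y E)) H))
      (at E within D)"
  proof (rule has_derivative_transform_eventually[OF der])
    have "\<forall>\<^sub>F F in at E within D. F \<in> D" by (simp add: eventually_at_filter)
    with du(1) dv(1) show "\<forall>\<^sub>F F in at E within D.
        cmod (vdot (v F) (u F)) / (norm (v F) * norm (u F)) = cmod (vdot (y F) (x F))"
      by eventually_elim (rule ratio)
    show "cmod (vdot (v E) (u E)) / (norm (v E) * norm (u E)) = cmod (vdot (y E) (x E))"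
      using ratio[OF E] wx zy by simp
  qed (rule E)
qed

section \<open>Matrices of rank two and their tangent spaces\<close>

lemma matrix_mult_component_2: "(W ** C) $ i = W $ i $ 1 *s C $ 1 + W $ i $ 2 *s C $ 2"
  for W :: "'a::comm_semiring_1^2^'m"
  by (simp add: matrix_matrix_mult_def sum_2 vec_eq_iff)

text \<open>Rank two means a full-rank factorization through a two-dimensional space. The rank is the dimension of the
  row space, so \<open>C\<close> consists of two rows of \<open>M\<close> that form a basis of it, and \<open>W\<close> holds the coordinates of the
  rows of \<open>M\<close>. The one-sided inverses express full rank without mentioning bases, which makes the
  criterion stable under multiplication by invertible matrices.\<close>

lemma rank_eq_2_iff:
  fixes M :: "'a::field^'n^'m"
  shows "rank M = 2 \<longleftrightarrow> (\<exists>(W :: 'a^2^'m) (C :: 'a^'n^2) L R.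
    M = W ** C \<and> L ** W = mat 1 \<and> C ** R = mat 1)"
proof
  assume "rank M = 2"
  then obtain B where B: "B \<subseteq> rows M" "vec.independent B" "rows M \<subseteq> vec.span B" "card B = 2"
    using vec.basis_exists[of "rows M"] unfolding row_rank_def_gen by metis
  then obtain b1 b2 where b: "B = {b1, b2}" "b1 \<noteq> b2" by (auto simp: card_2_iff)
  have ind: "b1 \<notin> vec.span {b2}" "b2 \<noteq> 0"
    using B(2) b by (auto simp: vec.independent_insert)
  have "\<exists>p. \<exists>q. M $ i = p *s b1 + q *s b2" for i
  proof -
    have "M $ i \<in> rows M" by (auto simp: rows_def row_def)
    then have "M $ i \<in> vec.span {b1, b2}" using B(3) b(1) by blast
    then obtain p q where "M $ i - p *s b1 = q *s b2"
      by (auto simp: vec.span_insert vec.span_singleton)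
    then have "M $ i = p *s b1 + q *s b2" by (simp add: algebra_simps)
    then show ?thesis by blast
  qed
  then obtain p q where pq: "\<And>i. M $ i = p i *s b1 + q i *s b2" by metis
  define W :: "'a^2^'m" where "W = (\<chi> i j. if j = 1 then p i else q i)"
  define C :: "'a^'n^2" where "C = (\<chi> j. if j = 1 then b1 else b2)"
  have M: "M = W ** C"
    using pq by (subst vec_eq_iff) (simp add: matrix_mult_component_2 W_def C_def)
  obtain i1 i2 where i: "b1 = M $ i1" "b2 = M $ i2"
    using B(1) b by (auto simp: rows_def row_def)
  \<comment> \<open>\<open>D\<close> selects the two basis rows, so \<open>D W C = C\<close>; cancelling \<open>C\<close> shows that \<open>D\<close> is a left inverse of \<open>W\<close>\<close>
  define D :: "'a^'m^2" where "D = (\<chi> j k. if k = (if j = 1 then i1 else i2) then 1 else 0)"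
  have delta: "(\<Sum>k\<in>UNIV. (if k = i then 1 else 0) * g k) = g i" for i and g :: "'m \<Rightarrow> 'a"
  proof -
    have "(if k = i then 1 else 0) * g k = (if k = i then g k else 0)" for k by simp
    then show ?thesis by simp
  qed
  have D: "C = D ** M"
    by (simp only: vec_eq_iff forall_2 C_def D_def i matrix_matrix_mult_def vec_lambda_beta delta) simp
  have "c 1 = 0 \<and> c 2 = 0" if "c 1 *s b1 + c 2 *s b2 = 0" for c :: "2 \<Rightarrow> 'a"
  proof -
    have "c 1 = 0"
    proof (rule ccontr)
      assume c1: "c 1 \<noteq> 0"
      have "b1 = (1 / c 1) *s (c 1 *s b1)" using c1 by (simp add: vector_smult_assoc)
      also have "c 1 *s b1 = - (c 2 *s b2)" using that by (simp add: eq_neg_iff_add_eq_0)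
      finally have "b1 = (- (c 2 / c 1)) *s b2" by (simp add: vector_smult_assoc)
      then have "b1 \<in> vec.span {b2}" unfolding vec.span_singleton by (rule range_eqI)
      then show False using ind(1) by simp
    qed
    with that ind(2) show ?thesis by simp
  qed
  then have "\<exists>R :: 'a^2^'n. C ** R = mat 1"
    unfolding matrix_right_invertible_independent_rows by (simp add: sum_2 forall_2 row_def C_def)
  then obtain R where R: "C ** R = mat 1" by blast
  have "(D ** W) ** (C ** R) = C ** R" using D M by (metis matrix_mul_assoc)
  then have "D ** W = mat 1" by (simp add: R)
  with M R show "\<exists>(W :: 'a^2^'m) (C :: 'a^'n^2) L R.
    M = W ** C \<and> L ** W = mat 1 \<and> C ** R = mat 1" by blast
next
  assume "\<exists>(W :: 'a^2^'m) (C :: 'a^'n^2) L R. M = W ** C \<and> L ** W = mat 1 \<and> C ** R = mat 1"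
  then obtain W :: "'a^2^'m" and C :: "'a^'n^2" and L R
    where M: "M = W ** C" "L ** W = mat 1" "C ** R = mat 1" by blast
  have C: "C = L ** M" using M by (metis matrix_mul_assoc matrix_mul_lid)
  have rowsM: "rows M \<subseteq> vec.span {C $ 1, C $ 2}"
  proof
    fix r assume "r \<in> rows M"
    then obtain i where "r = M $ i" by (auto simp: rows_def row_def)
    then have "r = W $ i $ 1 *s C $ 1 + W $ i $ 2 *s C $ 2"
      by (simp only: M(1) matrix_mult_component_2)
    then show "r \<in> vec.span {C $ 1, C $ 2}"
      by (simp add: vec.span_add vec.span_scale vec.span_base)
  qed
  have "C $ j \<in> vec.span (rows M)" for j
  proof -
    have "C $ j = (\<Sum>k\<in>UNIV. L $ j $ k *s M $ k)"
      by (subst C) (simp add: matrix_matrix_mult_def vec_eq_iff)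
    also have "\<dots> \<in> vec.span (rows M)"
      by (intro vec.span_sum vec.span_scale vec.span_base) (auto simp: rows_def row_def)
    finally show ?thesis .
  qed
  then have span: "vec.span {C $ 1, C $ 2} = vec.span (rows M)"
    using rowsM by (simp add: vec.span_eq)
  have CR: "(\<Sum>k\<in>UNIV. C $ i $ k * R $ k $ j) = (if i = j then 1 else 0)" for i j
    using arg_cong[OF M(3), of "\<lambda>N. N $ i $ j"] by (simp add: matrix_matrix_mult_def mat_def)
  have C2: "C $ 2 \<noteq> 0" using CR[of 2 2] by auto
  have "C $ 1 \<notin> vec.span {C $ 2}"
  proof
    assume "C $ 1 \<in> vec.span {C $ 2}"
    then obtain k where "C $ 1 = k *s C $ 2" by (auto simp: vec.span_singleton)
    then have "(\<Sum>l\<in>UNIV. C $ 1 $ l * R $ l $ 1) = k * (\<Sum>l\<in>UNIV. C $ 2 $ l * R $ l $ 1)"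
      by (simp add: sum_distrib_left mult.assoc)
    then show False by (simp add: CR)
  qed
  then have "vec.independent {C $ 1, C $ 2}" "C $ 1 \<noteq> C $ 2"
    using C2 by (auto simp: vec.independent_insert intro: vec.span_base)
  then show "rank M = 2"
    using vec.dim_eq_card[OF span] by (simp add: row_rank_def_gen)
qed

lemma thin_qr_2:
  fixes W :: "complex^2^'n"
  assumes inj: "L ** W = mat 1"
  obtains Q R where "ctrans Q ** Q = mat 1" "W = Q ** R" "invertible (R :: complex^2^2)"
proof -
  have ker: "v = 0" if "W *v v = 0" for v
  proof -
    have "v = (L ** W) *v v" by (simp add: inj)
    also have "\<dots> = 0" by (simp add: that flip: matrix_vector_mul_assoc)
    finally show ?thesis .
  qed
  define w where "w j = column j W" for j
  have Wv: "W *v v = v $ 1 *s w 1 + v $ 2 *s w 2" for v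
    by (simp add: matrix_vector_mult_def sum_2 w_def column_def vec_eq_iff mult.commute)
  have w1: "w 1 \<noteq> 0" using ker[of "vector [1, 0]"] by (auto simp: Wv vec_eq_iff forall_2)
  define q1 where "q1 = (1 / norm (w 1)) *s w 1"
  define r where "r = vdot q1 (w 2)"
  define v where "v = w 2 - r *s q1"
  have v0: "v \<noteq> 0"
  proof
    assume "v = 0"
    then have "W *v vector [- r / norm (w 1), 1] = 0"
      by (simp add: Wv v_def q1_def vector_smult_assoc)
    from ker[OF this] show False by (simp add: vec_eq_iff forall_2)
  qed
  define q2 where "q2 = (1 / norm v) *s v"
  have q11: "vdot q1 q1 = 1" using w1 by (simp add: vdot_self q1_def norm_vec_scale norm_divide)
  have q22: "vdot q2 q2 = 1" using v0 by (simp add: vdot_self q2_def norm_vec_scale norm_divide)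
  have q12: "vdot q1 q2 = 0"
    by (simp add: q2_def vdot_scale_right v_def vd.diff_right q11 r_def)
  then have q21: "vdot q2 q1 = 0" using cnj_vdot[of q1 q2] by simp
  define Q :: "complex^2^'n" where "Q = (\<chi> i j. if j = 1 then q1 $ i else q2 $ i)"
  define R :: "complex^2^2" where "R = vector [vector [norm (w 1), r], vector [0, norm v]]"
  show thesis
  proof
    show "ctrans Q ** Q = mat 1"
      using q11 q22 q12 q21
      by (simp add: vec_eq_iff forall_2 matrix_matrix_mult_def ctrans_def Q_def mat_def vdot_def)
    have "norm (w 1) *s q1 = w 1" using w1 by (simp add: q1_def vector_smult_assoc)
    then have 1: "norm (w 1) * q1 $ i = W $ i $ 1" for i
      by (simp add: vec_eq_iff w_def column_def)
    have "r *s q1 + norm v *s q2 = w 2"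
      using v0 by (simp add: q2_def vector_smult_assoc) (simp add: v_def)
    then have 2: "r * q1 $ i + norm v * q2 $ i = W $ i $ 2" for i
      by (simp add: vec_eq_iff w_def column_def)
    show "W = Q ** R"
      by (simp add: vec_eq_iff forall_2 matrix_matrix_mult_def sum_2 Q_def R_def mult.commute[of _ "complex_of_real _"] mult.commute[of _ r] 1 2)
    show "invertible R" using w1 v0 by (simp add: invertible_det_nz det_2 R_def)
  qed
qed

lemma rank2_factors_exist:
  assumes "E \<in> rank2_manifold"
  obtains U T V where "rank2_factors E U T V"
proof -
  obtain W :: "complex^2^'a" and C :: "complex^'a^2" and L R
    where E: "E = W ** C" "L ** W = mat 1" "C ** R = mat 1"
    using assms unfolding rank2_manifold_def mem_Collect_eq rank_eq_2_iff by blast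
  obtain U S where U: "ctrans U ** U = mat 1" "W = U ** S" "invertible (S :: complex^2^2)"
    using thin_qr_2[OF E(2)] by metis
  have "ctrans R ** ctrans C = mat 1" using E(3) by (simp flip: ctrans_mult)
  then obtain V S' where V: "ctrans V ** V = mat 1" "ctrans C = V ** S'" "invertible (S' :: complex^2^2)"
    using thin_qr_2 by metis
  have "C = ctrans S' ** ctrans V" using arg_cong[OF V(2), of ctrans] by (simp add: ctrans_mult)
  then have "E = U ** (S ** ctrans S') ** ctrans V" using E(1) U(2) by (simp add: matrix_mul_assoc)
  then have "rank2_factors E U (S ** ctrans S') V"
    using U V by (simp add: rank2_factors_def invertible_mult ctrans_invertible)
  then show thesis by (rule that)
qed

text \<open>The equations of the rank-2 manifold in the form used to differentiate along a curve: all compressions to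
  three by three matrices are singular.\<close>

lemma det_3_compression_rank_2:
  fixes a b :: "3 \<Rightarrow> complex^'n"
  assumes "rank M = 2"
  shows "det (\<chi> i j. vdot (a i) (M *v b j)) = 0"
proof -
  obtain W :: "complex^2^'n" and C :: "complex^'n^2" where M: "M = W ** C"
    using assms unfolding rank_eq_2_iff by blast
  define p where "p i k = cnj ((ctrans W *v a i) $ k)" for i k
  define q where "q j k = (C *v b j) $ k" for j k
  have "vdot (a i) (M *v b j) = p i 1 * q j 1 + p i 2 * q j 2" for i j
    by (simp add: M vdot_matrix[of _ W] flip: matrix_vector_mul_assoc)
       (simp add: vdot_def sum_2 p_def q_def)
  then show ?thesis by (simp add: det_3 algebra_simps)
qed

lemma invertible_mat_1_plus_small:
  fixes X :: "complex^'n^'n"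
  obtains \<delta> where "\<delta> > 0" "\<And>t :: real. \<bar>t\<bar> < \<delta> \<Longrightarrow> invertible (mat 1 + t *\<^sub>R X)"
proof -
  obtain K where K: "\<And>v. norm (X *v v) \<le> norm v * K" "K > 0"
    using mv.bounded_linear_right[THEN bounded_linear.pos_bounded, of X] by blast
  show thesis
  proof
    show "1 / K > 0" using K(2) by simp
    fix t :: real assume t: "\<bar>t\<bar> < 1 / K"
    show "invertible (mat 1 + t *\<^sub>R X)"
      unfolding invertible_iff_kernel
    proof (intro allI impI, rule ccontr)
      fix v assume v: "(mat 1 + t *\<^sub>R X) *v v = 0" "v \<noteq> 0"
      then have "v = - (t *\<^sub>R (X *v v))"
        by (simp add: matrix_vector_mult_add_rdistrib mv.scaleR_left eq_neg_iff_add_eq_0)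
      then have "norm v = \<bar>t\<bar> * norm (X *v v)" by (metis norm_minus_cancel norm_scaleR)
      also have "\<dots> \<le> \<bar>t\<bar> * (norm v * K)" using K(1) by (intro mult_left_mono) auto
      also have "\<dots> = (\<bar>t\<bar> * K) * norm v" by simp
      also have "\<dots> < 1 * norm v"
        using t K(2) v(2) by (intro mult_strict_right_mono) (auto simp: field_simps)
      finally show False by simp
    qed
  qed
qed

text \<open>The orthogonal projection onto the normal space, at \<open>U T V\<^sup>H\<close>, of the manifold of rank-2 matrices.\<close>

definition normal_part :: "complex^2^'n \<Rightarrow> complex^2^'n \<Rightarrow> complex^'n^'n \<Rightarrow> complex^'n^'n"
  where "normal_part U V Z = (mat 1 - U ** ctrans U) ** Z ** (mat 1 - V ** ctrans V)"

text \<open>Let \<open>U\<^sup>H a = 0\<close> and \<open>V\<^sup>H b = 0\<close>. Along a curve \<open>\<gamma>\<close> of rank-2 matrices through \<open>E\<close>, the compression by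
  \<open>(u\<^sub>1, u\<^sub>2, a)\<close> and \<open>(v\<^sub>1, v\<^sub>2, b)\<close> is singular. At time \<open>0\<close> it is block diagonal with blocks \<open>T\<close>
  and \<open>0\<close>, so the derivative of its determinant is \<open>det T \<cdot> a\<^sup>H H b\<close>. This must vanish, and \<open>det T \<noteq> 0\<close>.\<close>

lemma tangent_rank2_normal_part:
  assumes f: "rank2_factors E U T V" and H: "H \<in> tangent_space rank2_manifold E"
  shows "normal_part U V H = 0"
proof -
  have UU: "ctrans U ** U = mat 1" and VV: "ctrans V ** V = mat 1" and T: "invertible T"
    and E: "E = U ** T ** ctrans V"
    using f by (auto simp: rank2_factors_def)
  obtain \<gamma> \<delta> where g: "\<delta> > 0" "\<And>t :: real. \<bar>t\<bar> < \<delta> \<Longrightarrow> rank (\<gamma> t) = 2" "\<gamma> 0 = E"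
      "(\<gamma> has_vector_derivative H) (at 0)"
    using H by (auto simp: tangent_space_def rank2_manifold_def)
  have main: "vdot a (H *v b) = 0" if a: "ctrans U *v a = 0" and b: "ctrans V *v b = 0" for a b
  proof -
    define \<alpha> :: "3 \<Rightarrow> complex^'a" where
      "\<alpha> i = (if i = 1 then U *v axis 1 1 else if i = 2 then U *v axis 2 1 else a)" for i
    define \<beta> :: "3 \<Rightarrow> complex^'a" where
      "\<beta> i = (if i = 1 then V *v axis 1 1 else if i = 2 then V *v axis 2 1 else b)" for i
    define m where "m i j t = vdot (\<alpha> i) (\<gamma> t *v \<beta> j)" for i j t
    have dm: "(m i j has_vector_derivative vdot (\<alpha> i) (H *v \<beta> j)) (at 0)" for i j
      unfolding m_def[abs_def]
      using bounded_linear.has_vector_derivative[OF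
          bounded_linear_compose[OF vd.bounded_linear_right mv.bounded_linear_left] g(4)]
      by (simp add: o_def)
    have E\<beta>: "E *v (V *v c) = U *v (T *v c)" "E *v b = 0" for c
      unfolding E by (simp_all add: b VV matrix_vector_mul_assoc flip: matrix_mul_assoc)
         (simp add: b flip: matrix_vector_mul_assoc)
    have vU: "vdot (U *v c) (U *v d) = vdot c d" "vdot a (U *v d) = 0" for c d
      by (simp_all add: vdot_matrix a vd.zero_left)
         (simp add: UU matrix_vector_mul_assoc)
    have T0: "vdot (axis i 1) (T *v axis j 1) = T $ i $ j" for i j
      by (simp add: vdot_def matrix_vector_mult_def axis_def if_distrib if_distribR cong: if_cong)
    have m0: "m 1 1 0 = T $ 1 $ 1" "m 1 2 0 = T $ 1 $ 2" "m 2 1 0 = T $ 2 $ 1" "m 2 2 0 = T $ 2 $ 2"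
      "m 3 1 0 = 0" "m 3 2 0 = 0" "m i 3 0 = 0" for i
      by (simp_all add: m_def \<alpha>_def \<beta>_def g(3) E\<beta> vU T0 vd.zero_right)
    define D where "D t = m 1 1 t * m 2 2 t * m 3 3 t + m 1 2 t * m 2 3 t * m 3 1 t
      + m 1 3 t * m 2 1 t * m 3 2 t - m 1 1 t * m 2 3 t * m 3 2 t - m 1 2 t * m 2 1 t * m 3 3 t
      - m 1 3 t * m 2 2 t * m 3 1 t" for t
    have "(D has_vector_derivative (T $ 1 $ 1 * T $ 2 $ 2 - T $ 1 $ 2 * T $ 2 $ 1) * vdot (\<alpha> 3) (H *v \<beta> 3)) (at 0)"
      unfolding D_def[abs_def]
      by (rule has_vector_derivative_eq_rhs, (rule derivative_intros dm)+) (simp add: m0 algebra_simps)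
    moreover have "(D has_vector_derivative 0) (at 0)"
    proof (rule has_vector_derivative_transform_within_open[OF has_vector_derivative_const[of 0]])
      show "open {-\<delta><..<\<delta>}" "(0::real) \<in> {-\<delta><..<\<delta>}" using g(1) by auto
      fix t assume "t \<in> {-\<delta><..<\<delta>}"
      then have "rank (\<gamma> t) = 2" using g(2)[of t] by auto
      from det_3_compression_rank_2[OF this, of \<alpha> \<beta>] show "0 = D t"
        by (simp add: det_3 D_def m_def)
    qed
    ultimately have "(T $ 1 $ 1 * T $ 2 $ 2 - T $ 1 $ 2 * T $ 2 $ 1) * vdot (\<alpha> 3) (H *v \<beta> 3) = 0"
      by (rule vector_derivative_unique_at)
    moreover have "T $ 1 $ 1 * T $ 2 $ 2 - T $ 1 $ 2 * T $ 2 $ 1 \<noteq> 0"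
      using T by (simp add: invertible_det_nz det_2)
    ultimately show ?thesis by (simp add: \<alpha>_def \<beta>_def)
  qed
  have "normal_part U V H *v q = 0" for q
  proof -
    define p where "p = normal_part U V H *v q"
    define a where "a = p - U *v (ctrans U *v p)"
    define b where "b = q - V *v (ctrans V *v q)"
    have "ctrans U *v a = 0" "ctrans V *v b = 0"
      by (simp_all add: a_def b_def matrix_vector_mult_diff_distrib matrix_vector_mul_assoc UU VV
          matrix_mul_assoc)
    then have "vdot a (H *v b) = 0" by (rule main)
    moreover have "vdot p (normal_part U V H *v q) = vdot a (H *v b)"
    proof -
      have "normal_part U V H *v q = H *v b - U *v (ctrans U *v (H *v b))"
        by (simp add: normal_part_def b_def matrix_vector_mult_diff_rdistrib flip: matrix_vector_mul_assoc)
      then show ?thesis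
        by (simp add: a_def vd.diff_left vd.diff_right vdot_matrix[of p U] vdot_matrix[of _ "ctrans U"])
    qed
    ultimately have "vdot p p = 0" by (simp add: p_def)
    then show ?thesis by (simp add: vdot_self p_def)
  qed
  then show ?thesis by (simp add: matrix_eq)
qed

text \<open>The curve \<open>(I + t X) E (I + t Y)\<close> has rank two for small \<open>t\<close> and velocity \<open>X E + E Y\<close>. With the
  pseudoinverse \<open>P = V T\<^bsup>-1\<^esup> U\<^sup>H\<close> of \<open>E\<close>, one has \<open>P E = V V\<^sup>H\<close> and \<open>E P = U U\<^sup>H\<close>; hence \<open>X = H P\<close> and
  \<open>Y = P (H - H V V\<^sup>H)\<close> produce the velocity \<open>H\<close> minus its normal part.\<close>

lemma normal_part_zero_tangent_rank2:
  assumes f: "rank2_factors E U T V" and H: "normal_part U V H = 0"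
  shows "H \<in> tangent_space rank2_manifold E"
proof -
  have UU: "ctrans U ** U = mat 1" and VV: "ctrans V ** V = mat 1" and E: "E = U ** T ** ctrans V"
    using f by (auto simp: rank2_factors_def)
  obtain T' where T': "T ** T' = mat 1" "T' ** T = mat 1"
    using f by (auto simp: rank2_factors_def invertible_def)
  define P where "P = V ** T' ** ctrans U"
  have PE: "P ** E = V ** ctrans V"
  proof -
    have "P ** E = V ** T' ** (ctrans U ** U) ** T ** ctrans V" by (simp add: P_def E matrix_mul_assoc)
    also have "\<dots> = V ** (T' ** T) ** ctrans V" by (simp add: UU matrix_mul_assoc)
    finally show ?thesis by (simp add: T')
  qed
  have EP: "E ** P = U ** ctrans U"
  proof -
    have "E ** P = U ** T ** (ctrans V ** V) ** T' ** ctrans U" by (simp add: P_def E matrix_mul_assoc)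
    also have "\<dots> = U ** (T ** T') ** ctrans U" by (simp add: VV matrix_mul_assoc)
    finally show ?thesis by (simp add: T')
  qed
  define X where "X = H ** P"
  define Y where "Y = P ** (H - H ** (V ** ctrans V))"
  have "X ** E + E ** Y = H ** (V ** ctrans V) + U ** ctrans U ** (H - H ** (V ** ctrans V))"
    by (simp add: X_def Y_def PE EP matrix_mul_assoc flip: EP) (simp add: PE flip: matrix_mul_assoc)
  also have "\<dots> = H - normal_part U V H"
    by (simp add: normal_part_def matrix_diff_ldistrib matrix_diff_rdistrib matrix_mul_assoc)
  finally have XY: "X ** E + E ** Y = H" by (simp add: H)
  obtain \<delta>1 where d1: "\<delta>1 > 0" "\<And>t :: real. \<bar>t\<bar> < \<delta>1 \<Longrightarrow> invertible (mat 1 + t *\<^sub>R X)"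
    using invertible_mat_1_plus_small by blast
  obtain \<delta>2 where d2: "\<delta>2 > 0" "\<And>t :: real. \<bar>t\<bar> < \<delta>2 \<Longrightarrow> invertible (mat 1 + t *\<^sub>R Y)"
    using invertible_mat_1_plus_small by blast
  define \<gamma> where "\<gamma> t = (mat 1 + t *\<^sub>R X) ** E ** (mat 1 + t *\<^sub>R Y)" for t :: real
  have "rank (\<gamma> t) = 2" if t: "\<bar>t\<bar> < min \<delta>1 \<delta>2" for t
  proof -
    obtain X' where X': "X' ** (mat 1 + t *\<^sub>R X) = mat 1"
      using d1(2)[of t] t by (auto simp: invertible_def)
    obtain Y' where Y': "(mat 1 + t *\<^sub>R Y) ** Y' = mat 1"
      using d2(2)[of t] t by (auto simp: invertible_def)
    have "\<gamma> t = ((mat 1 + t *\<^sub>R X) ** U ** T) ** (ctrans V ** (mat 1 + t *\<^sub>R Y))"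
      by (simp add: \<gamma>_def E matrix_mul_assoc)
    moreover have "(T' ** ctrans U ** X') ** ((mat 1 + t *\<^sub>R X) ** U ** T) = mat 1"
    proof -
      have "(T' ** ctrans U ** X') ** ((mat 1 + t *\<^sub>R X) ** U ** T)
          = T' ** (ctrans U ** (X' ** (mat 1 + t *\<^sub>R X)) ** U) ** T" by (simp only: matrix_mul_assoc)
      then show ?thesis by (simp add: X' UU T')
    qed
    moreover have "(ctrans V ** (mat 1 + t *\<^sub>R Y)) ** (Y' ** V) = mat 1"
    proof -
      have "(ctrans V ** (mat 1 + t *\<^sub>R Y)) ** (Y' ** V) = ctrans V ** ((mat 1 + t *\<^sub>R Y) ** Y') ** V"
        by (simp only: matrix_mul_assoc)
      then show ?thesis by (simp add: Y' VV)
    qed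
    ultimately show ?thesis unfolding rank_eq_2_iff by blast
  qed
  moreover have "\<gamma> 0 = E" by (simp add: \<gamma>_def)
  moreover have "(\<gamma> has_vector_derivative H) (at 0)"
  proof -
    have "\<gamma> = (\<lambda>t. E + t *\<^sub>R H + t\<^sup>2 *\<^sub>R (X ** E ** Y))"
      by (simp add: fun_eq_iff \<gamma>_def matrix_add_ldistrib matrix_add_rdistrib matrix_scalar_ac
          scalar_matrix_assoc[symmetric] power2_eq_square scaleR_add_right flip: XY)
    moreover have "((\<lambda>t. E + t *\<^sub>R H + t\<^sup>2 *\<^sub>R (X ** E ** Y)) has_vector_derivative H) (at 0)"
      by (auto intro!: derivative_eq_intros)
    ultimately show ?thesis by simp
  qed
  ultimately show ?thesis
    unfolding tangent_space_def rank2_manifold_def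
    using d1(1) d2(1) by (auto intro!: exI[of _ \<gamma>] exI[of _ "min \<delta>1 \<delta>2"])
qed

lemma tangent_space_rank2_manifold:
  assumes "rank2_factors E U T V"
  shows "tangent_space rank2_manifold E = {H. normal_part U V H = 0}"
  using tangent_rank2_normal_part[OF assms] normal_part_zero_tangent_rank2[OF assms] by blast

lemma tangent_space_unit_sphere:
  assumes "E \<in> unit_sphere"
  shows "tangent_space unit_sphere E = {H. inner E H = 0}"
proof (intro equalityI subsetI CollectI)
  fix H assume "H \<in> tangent_space unit_sphere E"
  then obtain \<gamma> \<delta> where g: "\<delta> > 0" "\<And>t :: real. \<bar>t\<bar> < \<delta> \<Longrightarrow> norm (\<gamma> t) = 1" "\<gamma> 0 = E"
      "(\<gamma> has_vector_derivative H) (at 0)"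
    by (auto simp: tangent_space_def unit_sphere_eq)
  have "((\<lambda>t. inner (\<gamma> t) (\<gamma> t)) has_vector_derivative inner E H + inner H E) (at 0)"
    using bounded_bilinear.has_vector_derivative[OF bounded_bilinear_inner g(4,4)] g(3) by simp
  moreover have "((\<lambda>t. inner (\<gamma> t) (\<gamma> t)) has_vector_derivative 0) (at 0)"
  proof (rule has_vector_derivative_transform_within_open[OF has_vector_derivative_const[of 1]])
    show "open {-\<delta><..<\<delta>}" "(0::real) \<in> {-\<delta><..<\<delta>}" using g(1) by auto
    fix t assume "t \<in> {-\<delta><..<\<delta>}"
    then show "1 = inner (\<gamma> t) (\<gamma> t)" using g(2)[of t] by (auto simp: abs_less_iff simp flip: power2_norm_eq_inner)
  qed
  ultimately have "inner E H + inner H E = 0" by (rule vector_derivative_unique_at)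
  then show "inner E H = 0" by (simp add: inner_commute)
next
  fix H assume "H \<in> {H. inner E H = 0}"
  then have EH: "inner E H = 0" by simp
  have E: "inner E E = 1" using assms by (simp add: unit_sphere_eq flip: power2_norm_eq_inner)
  define h where "h = norm H"
  \<comment> \<open>the great circle through \<open>E\<close>; for \<open>H = 0\<close> it degenerates to a constant, since then \<open>sin (t * h) / h = 0\<close>\<close>
  define \<gamma> where "\<gamma> t = cos (t * h) *\<^sub>R E + (sin (t * h) / h) *\<^sub>R H" for t
  have "norm (\<gamma> t) = 1" for t
  proof (cases "h = 0")
    case True
    then show ?thesis using assms by (simp add: \<gamma>_def unit_sphere_eq)
  next
    case False
    have "(norm (\<gamma> t))\<^sup>2 = (cos (t * h))\<^sup>2 + (sin (t * h) / h)\<^sup>2 * (norm H)\<^sup>2"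
      unfolding power2_norm_eq_inner
      by (simp add: \<gamma>_def inner_add_left inner_add_right EH E inner_commute[of H E] power2_eq_square)
    also have "\<dots> = 1" using False by (simp add: h_def[symmetric] power_divide)
    finally have "(norm (\<gamma> t))\<^sup>2 = 1\<^sup>2" by simp
    then show ?thesis by (rule power2_eq_imp_eq) simp_all
  qed
  moreover have "\<gamma> 0 = E" by (simp add: \<gamma>_def)
  moreover have "(\<gamma> has_vector_derivative H) (at 0)"
  proof -
    have "((\<lambda>t. sin (t * h) / h) has_real_derivative (h / h)) (at 0)"
      by (auto intro!: derivative_eq_intros)
    moreover have "((\<lambda>t. cos (t * h)) has_real_derivative 0) (at 0)"
      by (auto intro!: derivative_eq_intros)
    ultimately have "(\<gamma> has_vector_derivative (0 *\<^sub>R E + (h / h) *\<^sub>R H)) (at 0)"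
      unfolding \<gamma>_def[abs_def] by (auto intro!: derivative_eq_intros)
    moreover have "(h / h) *\<^sub>R H = H" by (cases "H = 0") (simp_all add: h_def)
    ultimately show ?thesis by simp
  qed
  ultimately show "H \<in> tangent_space unit_sphere E"
    unfolding tangent_space_def unit_sphere_eq by (auto intro!: exI[of _ \<gamma>] exI[of _ 1])
qed

section \<open>The projected gradient\<close>

lemma orth_proj_eqI:
  assumes "P \<in> W" "\<And>H. H \<in> W \<Longrightarrow> inner H (Z - P) = 0" "\<And>H K. H \<in> W \<Longrightarrow> K \<in> W \<Longrightarrow> H - K \<in> W"
  shows "orth_proj W Z = P"
  unfolding orth_proj_def Re_frob_inner
proof (rule the_equality)
  fix P' assume P': "P' \<in> W \<and> (\<forall>H\<in>W. inner H (Z - P') = 0)"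
  then have "P' - P \<in> W" using assms by blast
  then have "inner (P' - P) (Z - P) = 0" "inner (P' - P) (Z - P') = 0" using assms(2) P' by auto
  then have "inner (P' - P) (P' - P) = 0" by (simp add: inner_diff_right)
  then show "P' = P" by simp
qed (use assms in auto)

lemma P_tan_normal_part:
  assumes "rank2_factors E U T V"
  shows "P_tan E Z = Z - normal_part U V Z"
  using P_tan_eq[OF assms] by (simp add: normal_part_def)

lemma normal_part_diff: "normal_part U V (Z - Z') = normal_part U V Z - normal_part U V Z'"
  by (simp add: normal_part_def matrix_diff_ldistrib matrix_diff_rdistrib)

lemma normal_part_scaleR: "normal_part U V (c *\<^sub>R Z) = c *\<^sub>R normal_part U V Z"
  by (simp add: normal_part_def matrix_scalar_ac scalar_matrix_assoc)

lemma inner_normal_part: "inner (normal_part U V H) Z = inner H (normal_part U V Z)"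
proof -
  have sa: "ctrans (mat 1 - U ** ctrans U) = mat 1 - U ** ctrans U" for U :: "complex^2^'a"
    by (simp add: ctrans_diff ctrans_mult)
  show ?thesis
    by (simp only: normal_part_def inner_mult_right[of "_ ** H"] inner_mult_left[of _ H] sa matrix_mul_assoc)
qed

lemma complement_projector_idem:
  assumes "ctrans U ** U = mat 1"
  shows "(mat 1 - U ** ctrans U) ** (mat 1 - U ** ctrans U) = mat 1 - U ** ctrans U"
proof -
  have "U ** ctrans U ** (U ** ctrans U) = U ** (ctrans U ** U) ** ctrans U"
    by (simp only: matrix_mul_assoc)
  then show ?thesis
    by (simp add: assms matrix_diff_ldistrib matrix_diff_rdistrib)
qed

lemma normal_part_idem:
  assumes "rank2_factors E U T V"
  shows "normal_part U V (normal_part U V Z) = normal_part U V Z"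
proof -
  have UV: "ctrans U ** U = mat 1" "ctrans V ** V = mat 1"
    using assms by (auto simp: rank2_factors_def)
  have "normal_part U V (normal_part U V Z) = ((mat 1 - U ** ctrans U) ** (mat 1 - U ** ctrans U)) ** Z
      ** ((mat 1 - V ** ctrans V) ** (mat 1 - V ** ctrans V))"
    by (simp only: normal_part_def matrix_mul_assoc)
  then show ?thesis by (simp only: complement_projector_idem UV) (simp add: normal_part_def)
qed

lemma normal_part_self:
  assumes "rank2_factors E U T V"
  shows "normal_part U V E = 0"
proof -
  have E: "E = U ** T ** ctrans V" and U: "ctrans U ** U = mat 1" 
    using assms by (auto simp: rank2_factors_def)
  have "U ** ctrans U ** E = U ** (ctrans U ** U) ** T ** ctrans V"
    by (simp only: E matrix_mul_assoc)
  then have "(mat 1 - U ** ctrans U) ** E = 0"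
    by (simp add: matrix_diff_rdistrib U) (simp add: E)
  then show ?thesis by (simp add: normal_part_def)
qed

text \<open>The two normal directions, \<open>E\<close> itself and the normal space of the rank-2 manifold, are orthogonal, because
  \<open>E\<close> has no normal part. Removing both components one after the other therefore projects onto the
  intersection.\<close>

lemma tangential_part_in_tangent_space:
  assumes E: "E \<in> unit_sphere" "E \<in> rank2_manifold"
  shows "P_tan E Z - inner E Z *\<^sub>R E \<in> tangent_space unit_sphere E \<inter> tangent_space rank2_manifold E"
    and "H \<in> tangent_space unit_sphere E \<inter> tangent_space rank2_manifold E
      \<Longrightarrow> inner H (P_tan E Z - inner E Z *\<^sub>R E) = inner H Z"
proof -
  obtain U T V where f: "rank2_factors E U T V" using rank2_factors_exist[OF E(2)] .
  have EE: "inner E E = 1" using E(1) by (simp add: unit_sphere_eq flip: power2_norm_eq_inner)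
  have "inner E (normal_part U V Z) = 0"
    using inner_normal_part[of U V E Z] by (simp add: normal_part_self[OF f])
  then show "P_tan E Z - inner E Z *\<^sub>R E \<in> tangent_space unit_sphere E \<inter> tangent_space rank2_manifold E"
    by (simp add: tangent_space_unit_sphere[OF E(1)] tangent_space_rank2_manifold[OF f]
        P_tan_normal_part[OF f] inner_diff_right EE normal_part_diff normal_part_scaleR
        normal_part_idem[OF f] normal_part_self[OF f])
  assume "H \<in> tangent_space unit_sphere E \<inter> tangent_space rank2_manifold E"
  then have H: "inner E H = 0" "normal_part U V H = 0"
    by (simp_all add: tangent_space_unit_sphere[OF E(1)] tangent_space_rank2_manifold[OF f])
  have "inner H (normal_part U V Z) = 0"
    using inner_normal_part[of U V H Z] H by simp
  then show "inner H (P_tan E Z - inner E Z *\<^sub>R E) = inner H Z"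
    using H(1) by (simp add: P_tan_normal_part[OF f] inner_diff_right inner_commute[of H E])
qed

text \<open>A gradient relative to the sphere is determined only up to multiples of \<open>E\<close>; its pairing with tangent
  vectors is determined, and this suffices to identify the projection.\<close>

lemma orth_proj_tangent_spaces:
  assumes E: "E \<in> unit_sphere" "E \<in> rank2_manifold"
    and Z: "\<And>H. H \<in> tangent_space unit_sphere E \<Longrightarrow> inner Z H = k * inner S H"
  shows "orth_proj (tangent_space unit_sphere E \<inter> tangent_space rank2_manifold E) Z
    = k *\<^sub>R (P_tan E S - inner E S *\<^sub>R E)"
proof (rule orth_proj_eqI)
  obtain U T V where f: "rank2_factors E U T V" using rank2_factors_exist[OF E(2)] .
  note T = tangent_space_unit_sphere[OF E(1)] tangent_space_rank2_manifold[OF f]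
  show "k *\<^sub>R (P_tan E S - inner E S *\<^sub>R E) \<in> tangent_space unit_sphere E \<inter> tangent_space rank2_manifold E"
    using tangential_part_in_tangent_space(1)[OF E, of S] unfolding T
    by (simp add: normal_part_scaleR)
  show "H - K \<in> tangent_space unit_sphere E \<inter> tangent_space rank2_manifold E"
    if "H \<in> tangent_space unit_sphere E \<inter> tangent_space rank2_manifold E"
      "K \<in> tangent_space unit_sphere E \<inter> tangent_space rank2_manifold E" for H K
    using that unfolding T by (simp add: normal_part_diff inner_diff_right)
  fix H assume H: "H \<in> tangent_space unit_sphere E \<inter> tangent_space rank2_manifold E"
  have "inner H Z = k * inner H S" using Z[of H] H by (simp add: inner_commute)
  then show "inner H (Z - k *\<^sub>R (P_tan E S - inner E S *\<^sub>R E)) = 0"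
    using tangential_part_in_tangent_space(2)[OF E H, of S]
    by (simp only: inner_diff_right[of H Z] inner_scaleR_right)
qed

text \<open>Tangent vectors are velocities of curves in the sphere, along which the derivative of \<open>f\<close> is
  unique.\<close>

lemma derivative_within_sphere_unique:
  assumes "(f has_derivative f') (at E within unit_sphere)" "(f has_derivative f'') (at E within unit_sphere)"
    and "H \<in> tangent_space unit_sphere E"
  shows "f' H = (f'' H :: real)"
proof -
  obtain \<gamma> \<delta> where g: "\<delta> > 0" "\<And>t :: real. \<bar>t\<bar> < \<delta> \<Longrightarrow> \<gamma> t \<in> unit_sphere" "\<gamma> 0 = E"
      "(\<gamma> has_vector_derivative H) (at 0)"
    using assms(3) by (auto simp: tangent_space_def)
  define I where "I = {-\<delta><..<\<delta>}"
  have I: "open I" "0 \<in> I" "\<gamma> ` I \<subseteq> unit_sphere" using g(1,2) by (auto simp: I_def)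
  have "((\<lambda>t. f (\<gamma> t)) has_vector_derivative F H) (at 0)"
    if F: "(f has_derivative F) (at E within unit_sphere)" for F
  proof -
    have 1: "(\<gamma> has_derivative (\<lambda>t. t *\<^sub>R H)) (at 0 within I)"
      using g(4) unfolding has_vector_derivative_def by (rule has_derivative_at_withinI)
    have 2: "(f has_derivative F) (at (\<gamma> 0) within \<gamma> ` I)"
      using has_derivative_subset[OF F I(3)] g(3) by simp
    have "((\<lambda>t. f (\<gamma> t)) has_derivative (\<lambda>t. F (t *\<^sub>R H))) (at 0 within I)"
      by (rule has_derivative_in_compose[OF 1 2])
    moreover have "F (t *\<^sub>R H) = t *\<^sub>R F H" for t
      by (rule linear_scale[OF has_derivative_linear[OF F]])
    ultimately show ?thesis
      by (simp add: has_vector_derivative_def at_within_open[OF I(2,1)])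
  qed
  from this[OF assms(1)] this[OF assms(2)] show ?thesis by (rule vector_derivative_unique_at)
qed

theorem theorem4p1:
  fixes A :: "complex^'n^'n" and lam0 :: complex and eps0 \<epsilon> :: real
    and lam :: "real \<Rightarrow> complex^'n^'n \<Rightarrow> complex"
    and x y :: "complex^'n^'n \<Rightarrow> complex^'n"
    and S :: "complex^'n^'n \<Rightarrow> complex^'n^'n"
    and f :: "complex^'n^'n \<Rightarrow> real"
  assumes "simple_eigenvalue A lam0"
    and "eps0 > 0" and "simple_continuation A lam0 eps0 lam"
    and "0 < \<epsilon>" and "\<epsilon> \<le> eps0"
    and "\<And>E. E \<in> unit_sphere \<Longrightarrow> unit_eigenvectors (A + \<epsilon> *\<^sub>R E) (lam \<epsilon> E) (x E) (y E)"
    and S_def: "\<And>E. S E = S_matrix (A + \<epsilon> *\<^sub>R E) (lam \<epsilon> E) (x E) (y E)"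
    and f_def: "\<And>E. f E = cmod (vdot (y E) (x E))"
  shows
    "(\<forall>E \<in> unit_sphere \<inter> rank2_manifold.
        (\<exists>Z. has_gradient_on unit_sphere f Z E) \<and>
        (\<forall>Z. has_gradient_on unit_sphere f Z E \<longrightarrow>
           antiparallel (ode_rhs S E)
             (orth_proj (tangent_space unit_sphere E \<inter> tangent_space rank2_manifold E) Z))) \<and>
     (\<forall>I E. is_solution_on I S E \<longrightarrow> (\<forall>t\<in>I.
        ((\<lambda>s. f (E s)) has_real_derivative
           - \<epsilon> * f (E t)
             * (frob_norm (P_tan (E t) (S (E t)) - Re (frob_inner (E t) (S (E t))) *\<^sub>R E t))\<^sup>2)
           (at t within I) \<and>
        (((\<lambda>s. f (E s)) has_real_derivative 0) (at t within I) \<longleftrightarrow>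
           (E has_vector_derivative 0) (at t within I))))"
proof -
  have grad: "f E > 0" "(f has_derivative (\<lambda>H. \<epsilon> * f E * inner (S E) H)) (at E within unit_sphere)"
    if E: "E \<in> unit_sphere" for E
  proof -
    have simple: "simple_eigenvalue (A + \<epsilon> *\<^sub>R E) (lam \<epsilon> E)"
      using assms(3-5) E unfolding simple_continuation_def by auto
    have tends: "(lam \<epsilon> \<longlongrightarrow> lam \<epsilon> E) (at E within unit_sphere)"
      using simple_continuation_tendsto[OF assms(3) _ assms(5) E] assms(4) by simp
    note d = eigenvalue_condition_has_derivative[of E unit_sphere A \<epsilon> "lam \<epsilon>" x y, OF E simple assms(6) tends]
    have "f = (\<lambda>F. cmod (vdot (y F) (x F)))" using f_def by blast
    with d show "f E > 0" "(f has_derivative (\<lambda>H. \<epsilon> * f E * inner (S E) H)) (at E within unit_sphere)"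
      by (simp_all add: S_def)
  qed
  have rhs: "ode_rhs S E = - (P_tan E (S E) - inner E (S E) *\<^sub>R E)" for E
    by (simp add: ode_rhs_def Re_frob_inner)
  have part1: "(\<exists>Z. has_gradient_on unit_sphere f Z E) \<and>
        (\<forall>Z. has_gradient_on unit_sphere f Z E \<longrightarrow>
           antiparallel (ode_rhs S E)
             (orth_proj (tangent_space unit_sphere E \<inter> tangent_space rank2_manifold E) Z))"
    if E: "E \<in> unit_sphere \<inter> rank2_manifold" for E
  proof (intro conjI allI impI)
    have E': "E \<in> unit_sphere" "E \<in> rank2_manifold" using E by auto
    have "has_gradient_on unit_sphere f ((\<epsilon> * f E) *\<^sub>R S E) E"
      using grad(2)[OF E'(1)] by (simp add: has_gradient_on_def Re_frob_inner mult.assoc)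
    then show "\<exists>Z. has_gradient_on unit_sphere f Z E" ..
    fix Z assume "has_gradient_on unit_sphere f Z E"
    then have "(f has_derivative (\<lambda>H. inner Z H)) (at E within unit_sphere)"
      by (simp add: has_gradient_on_def Re_frob_inner)
    then have "inner Z H = (\<epsilon> * f E) * inner (S E) H" if "H \<in> tangent_space unit_sphere E" for H
      using derivative_within_sphere_unique[OF _ grad(2)[OF E'(1)] that] by blast
    from orth_proj_tangent_spaces[OF E' this]
    have "orth_proj (tangent_space unit_sphere E \<inter> tangent_space rank2_manifold E) Z
        = (\<epsilon> * f E) *\<^sub>R (P_tan E (S E) - inner E (S E) *\<^sub>R E)" .
    then have "ode_rhs S E = - ((1 / (\<epsilon> * f E)) *\<^sub>R
        orth_proj (tangent_space unit_sphere E \<inter> tangent_space rank2_manifold E) Z)"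
      using grad(1)[OF E'(1)] assms(4) by (simp add: rhs)
    moreover have "1 / (\<epsilon> * f E) > 0" using grad(1)[OF E'(1)] assms(4) by simp
    ultimately show "antiparallel (ode_rhs S E)
        (orth_proj (tangent_space unit_sphere E \<inter> tangent_space rank2_manifold E) Z)"
      unfolding antiparallel_def by blast
  qed
  have part2: "((\<lambda>s. f (E s)) has_real_derivative
           - \<epsilon> * f (E t)
             * (frob_norm (P_tan (E t) (S (E t)) - Re (frob_inner (E t) (S (E t))) *\<^sub>R E t))\<^sup>2)
           (at t within I) \<and>
        (((\<lambda>s. f (E s)) has_real_derivative 0) (at t within I) \<longleftrightarrow>
           (E has_vector_derivative 0) (at t within I))"
    if sol: "is_solution_on I S E" and t: "t \<in> I" for I E t
  proof -
    define R where "R = P_tan (E t) (S (E t)) - inner (E t) (S (E t)) *\<^sub>R E t"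
    have Et: "E t \<in> unit_sphere" "E t \<in> rank2_manifold" and EI: "E ` I \<subseteq> unit_sphere"
      and dE: "(E has_vector_derivative - R) (at t within I)"
      using sol t by (auto simp: is_solution_on_def rhs R_def)
    have "inner R (S (E t)) = inner R R"
      using tangential_part_in_tangent_space(2)[OF Et tangential_part_in_tangent_space(1)[OF Et],
          of "S (E t)" "S (E t)"] by (simp only: R_def)
    then have SR: "inner (S (E t)) (- R) = - (norm R)\<^sup>2"
      by (simp add: power2_norm_eq_inner inner_commute)
    have "((\<lambda>s. f (E s)) has_derivative (\<lambda>s. \<epsilon> * f (E t) * inner (S (E t)) (s *\<^sub>R (- R)))) (at t within I)"
      using dE unfolding has_vector_derivative_def
      by (rule has_derivative_in_compose[OF _ has_derivative_subset[OF grad(2)[OF Et(1)] EI]])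
    moreover have "(\<lambda>s. \<epsilon> * f (E t) * inner (S (E t)) (s *\<^sub>R (- R))) = (*) (- \<epsilon> * f (E t) * (norm R)\<^sup>2)"
      unfolding inner_scaleR_right SR by (auto simp: fun_eq_iff)
    ultimately have df: "((\<lambda>s. f (E s)) has_real_derivative - \<epsilon> * f (E t) * (norm R)\<^sup>2) (at t within I)"
      by (simp add: has_field_derivative_def)
    have "((\<lambda>s. f (E s)) has_real_derivative 0) (at t within I) \<longleftrightarrow>
           (E has_vector_derivative 0) (at t within I)"
    \<comment> \<open>in a degenerate interval \<open>{t}\<close> every number is a derivative, so both sides of the equivalence hold\<close>
    proof (cases "at t within I = bot")
      case True
      then show ?thesis
        by (simp add: has_field_derivative_def has_vector_derivative_def has_derivative_bot
            bounded_linear_mult_right bounded_linear_zero)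
    next
      case False
      note df' = df[unfolded has_real_derivative_iff_has_vector_derivative]
      have "((\<lambda>s. f (E s)) has_real_derivative 0) (at t within I) \<longleftrightarrow> - \<epsilon> * f (E t) * (norm R)\<^sup>2 = 0"
        using vector_derivative_unique_within[OF False df', of 0] df'
        unfolding has_real_derivative_iff_has_vector_derivative by metis
      also have "\<dots> \<longleftrightarrow> R = 0" using assms(4) grad(1)[OF Et(1)] by simp
      also have "\<dots> \<longleftrightarrow> (E has_vector_derivative 0) (at t within I)"
        using vector_derivative_unique_within[OF False dE, of 0] dE by auto
      finally show ?thesis .
    qed
    with df show ?thesis by (simp add: R_def Re_frob_inner frob_norm_eq)
  qed
  show ?thesis using part1 part2 by blast
qed

end
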